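(* Let $p\ge 3$ be a prime, let $k\ge1$ be an integer, and let $J,J_1\in\mathbb{Q}_p$ satisfy $|J|_p\le\frac1p$ and $0<|J_1|_p\le\frac1p$. Put $a=\exp_p(J)$, $b=\exp_p(J_1)$, and let $(m,n)$ denote the greatest common divisor of $m$ and $n$. Assume that one of the following conditions is satisfied: (i) $(k,p)=1$ and $\frac{p-1}{(k,p-1)}$ is even; (ii) $k$ is odd and $\max\{|k|_p,|a-1|_p\}<|b-1|_p$. Then there exists a phase transition for the $p$-adic Ising-Vannimenus model with coupling constants $J,J_1$ on the Cayley tree $\Gamma^k_+$ of order $k$; that is, there are at least two distinct $p$-adic quasi Gibbs measures $\mu,\nu$ for the model such that $\mu$ is bounded and $\nu$ is unbounded.
   Context: Notation: $\mathbb{Q}_p$ is the field of $p$-adic numbers with norm $|\cdot|_p$, and $\exp_p(x)=\sum_{n\ge0}x^n/n!$ (convergent for $|x|_p<p^{-1/(p-1)}$). Tree: $\Gamma^k_+=(V,L)$ is the semi-infinite Cayley tree of order $k$ with root $x^0$: the root has $k$ edges and every other vertex has exactly $k+1$ edges. $d$ is the graph distance, $W_n=\{x\in V: d(x,x^0)=n\}$, $V_n=\bigcup_{m=0}^n W_m$, $L_n$ is the set of edges with both endpoints in $V_n$, and for $x\in W_n$, $S(x)=\{y\in W_{n+1}: d(x,y)=1\}$ (so $|S(x)|=k$). Edges are written $\langle x,y\rangle$ with $y\in S(x)$. Vertices $x,y$ are prolonged next-nearest neighbors, written $\rangle x,y\langle$, if $d(x,y)=2$ and $x\in W_{m-2}$,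 $y\in W_m$ for some $m$. Model: spins take values in $\Phi=\{-1,+1\}$; $\Omega=\Phi^V$, $\Omega_{V_n}=\Phi^{V_n}$, $\Omega_{W_n}=\Phi^{W_n}$; for $\sigma\in\Omega_{V_{n-1}}$, $\omega\in\Omega_{W_n}$, $\sigma\vee\omega\in\Omega_{V_n}$ is their concatenation. The Hamiltonian is $$H_n(\sigma)=J\sum_{\langle x,y\rangle\in L_n}\sigma(x)\sigma(y)+J_1\sum_{\rangle x,y\langle:\ x,y\in V_n}\sigma(x)\sigma(y),\quad \sigma\in\Omega_{V_n}.$$ Measures: a $p$-adic measure on $(X,\mathcal{B})$, with $\mathcal{B}$ an algebra of subsets of $X$, is a finitely additive function $\mu:\mathcal{B}\to\mathbb{Q}_p$; it is a probability measure if $\mu(X)=1$; it is bounded if $\sup\{|\mu(A)|_p: A\in\mathcal{B}\}<\infty$ and unbounded otherwise. Given $\mathbf{h}:\langle x,y\rangle\mapsto \mathbf{h}_{xy}=(h_{xy,++},h_{xy,+-},h_{xy,-+},h_{xy,--})\in\mathbb{Q}_p^4$ on $L$ (such that all expressions below are defined), put for $n\ge1$, $\sigma\in\Omega_{V_n}$ $$\mu^{(n)}_{\mathbf{h}}(\sigma)=\frac{1}{Z^{(\mathbf{h})}_n}\exp_p(H_n(\sigma))\prod_{x\in W_{n-1},\,y\in S(x)}\big(h_{xy,\sigma(x)\sigma(y)}\big)^{\sigma(x)\sigma(y)},$$ where the subscript $\sigma(x)\sigma(y)$ of $h$ denotes the ordered pair of signs of $\sigma(x)$ and $\sigma(y)$,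 the exponent is the product of the spins, and $Z^{(\mathbf{h})}_n$ is the normalizing factor (the sum of the same expressions over all $\sigma\in\Omega_{V_n}$). If the compatibility condition $\sum_{\omega\in\Omega_{W_n}}\mu^{(n)}_{\mathbf{h}}(\sigma\vee\omega)=\mu^{(n-1)}_{\mathbf{h}}(\sigma)$ holds for all $n\ge2$ and $\sigma\in\Omega_{V_{n-1}}$, there is a unique $p$-adic probability measure $\mu_{\mathbf{h}}$ on $\Omega$ (on the algebra of cylinder sets) with $\mu_{\mathbf{h}}(\{\sigma:\sigma|_{V_n}=\sigma_n\})=\mu^{(n)}_{\mathbf{h}}(\sigma_n)$ for all $n\ge 1$; such a measure is called a $p$-adic quasi Gibbs measure for the model. *)

theory Defs
  imports "HOL-Analysis.Analysis" "HOL-Computational_Algebra.Primes"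
begin

section \<open>The field of p-adic numbers\<close>

subsection \<open>The p-adic norm on the rationals\<close>

definition padic_norm_rat :: "nat \<Rightarrow> rat \<Rightarrow> real" where
  "padic_norm_rat p q =
    (if q = 0 then 0
     else real p powi (int (multiplicity (int p) (snd (quotient_of q)))
                       - int (multiplicity (int p) (fst (quotient_of q)))))"

lemma padic_norm_rat_0 [simp]: "padic_norm_rat p 0 = 0"
  by (simp add: padic_norm_rat_def)

lemma padic_norm_rat_nonneg [simp]: "padic_norm_rat p x \<ge> 0"
  by (simp add: padic_norm_rat_def)

lemma rat_fraction:
  obtains a b where "(x::rat) = of_int a / of_int b" "b \<noteq> 0"
proof -
  obtain c d where cd: "quotient_of x = (c, d)" by (cases "quotient_of x")
  show ?thesis
    using that[of c d] quotient_of_div[OF cd] quotient_of_denom_pos[OF cd] by auto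
qed

context
  fixes p :: nat
  assumes p: "prime p"
begin

lemma padic_norm_rat_divide:
  assumes "a \<noteq> 0" "b \<noteq> 0"
  shows "padic_norm_rat p (of_int a / of_int b)
           = real p powi (int (multiplicity (int p) b) - int (multiplicity (int p) a))"
proof -
  define q :: rat where "q = of_int a / of_int b"
  obtain c d where cd: "quotient_of q = (c, d)" by (cases "quotient_of q")
  have q: "q = of_int c / of_int d" and d: "d > 0"
    using quotient_of_div[OF cd] quotient_of_denom_pos[OF cd] by auto
  have "q \<noteq> 0" using assms by (simp add: q_def)
  then have c: "c \<noteq> 0" using q by auto
  have "(of_int (a * d) :: rat) = of_int (c * b)"
    using q q_def assms d by (simp add: field_simps)
  then have eq: "a * d = c * b" by (simp only: of_int_eq_iff)
  have pe: "prime_elem (int p)" using p by simp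
  have "multiplicity (int p) a + multiplicity (int p) d = multiplicity (int p) (a * d)"
    using assms d pe by (simp add: prime_elem_multiplicity_mult_distrib)
  also have "\<dots> = multiplicity (int p) c + multiplicity (int p) b"
    unfolding eq using assms c pe by (simp add: prime_elem_multiplicity_mult_distrib)
  finally have "int (multiplicity (int p) d) - int (multiplicity (int p) c)
      = int (multiplicity (int p) b) - int (multiplicity (int p) a)" by linarith
  then show ?thesis
    using \<open>q \<noteq> 0\<close> cd by (simp add: padic_norm_rat_def flip: q_def)
qed

lemma padic_norm_rat_eq_0_iff [simp]: "padic_norm_rat p x = 0 \<longleftrightarrow> x = 0"
  using p by (auto simp: padic_norm_rat_def power_int_eq_0_iff)

lemma padic_norm_rat_1 [simp]: "padic_norm_rat p 1 = 1"
  using padic_norm_rat_divide[of 1 1] by simp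

lemma padic_norm_rat_mult:
  "padic_norm_rat p (x * y) = padic_norm_rat p x * padic_norm_rat p y"
proof (cases "x = 0 \<or> y = 0")
  case False
  obtain a b where x: "x = of_int a / of_int b" "b \<noteq> 0" by (rule rat_fraction)
  obtain c d where y: "y = of_int c / of_int d" "d \<noteq> 0" by (rule rat_fraction)
  have nz: "a \<noteq> 0" "c \<noteq> 0" using False x y by auto
  have xy: "x * y = of_int (a * c) / of_int (b * d)" using x y by simp
  have pe: "prime_elem (int p)" using p by simp
  have p0: "real p \<noteq> 0" using p by auto
  show ?thesis
    unfolding xy unfolding x y using x(2) y(2) nz pe p0
    by (subst (1 2 3) padic_norm_rat_divide)
       (auto simp: prime_elem_multiplicity_mult_distrib power_int_diff power_int_add field_simps)
qed auto

lemma padic_norm_rat_minus [simp]: "padic_norm_rat p (- x) = padic_norm_rat p x"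
proof -
  have "padic_norm_rat p (-1) = 1"
    using padic_norm_rat_divide[of "-1" 1] by (simp add: multiplicity_unit_right)
  then show ?thesis using padic_norm_rat_mult[of "-1" x] by simp
qed

lemma padic_norm_rat_diff_commute: "padic_norm_rat p (x - y) = padic_norm_rat p (y - x)"
  using padic_norm_rat_minus[of "x - y"] by simp

lemma padic_norm_rat_ultrametric:
  "padic_norm_rat p (x + y) \<le> max (padic_norm_rat p x) (padic_norm_rat p y)"
proof (cases "x = 0 \<or> y = 0 \<or> x + y = 0")
  case True
  then show ?thesis by (auto simp: le_max_iff_disj)
next
  case False
  obtain a0 b where x0: "x = of_int a0 / of_int b" "b \<noteq> 0" by (rule rat_fraction)
  obtain c0 d where y0: "y = of_int c0 / of_int d" "d \<noteq> 0" by (rule rat_fraction)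
  define a c e where "a = a0 * d" and "c = c0 * b" and "e = b * d"
  have x: "x = of_int a / of_int e" and y: "y = of_int c / of_int e" and e: "e \<noteq> 0"
    using x0 y0 by (auto simp: a_def c_def e_def)
  have xy: "x + y = of_int (a + c) / of_int e" by (simp add: x y add_divide_distrib)
  have nz: "a \<noteq> 0" "c \<noteq> 0" "a + c \<noteq> 0" using False xy x y by auto
  define v where "v = multiplicity (int p)"
  have "int p ^ min (v a) (v c) dvd a + c"
    unfolding v_def
    by (intro dvd_add multiplicity_dvd') auto
  then have "v (a + c) \<ge> min (v a) (v c)"
    unfolding v_def using nz p by (intro multiplicity_geI) (auto dest: prime_gt_1_nat)
  then have "v a \<le> v (a + c) \<or> v c \<le> v (a + c)" by (auto simp: min_def split: if_splits)
  moreover have "real p powi (int (v e) - int (v (a + c))) \<le> real p powi (int (v e) - int u)"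
    if "u \<le> v (a + c)" for u
    using that p prime_gt_1_nat[OF p] by (intro power_int_increasing) auto
  ultimately show ?thesis
    unfolding xy unfolding x y
    using padic_norm_rat_divide[OF nz(1) e] padic_norm_rat_divide[OF nz(2) e]
      padic_norm_rat_divide[OF nz(3) e]
    by (auto simp: le_max_iff_disj v_def)
qed

lemma padic_norm_rat_triangle:
  "padic_norm_rat p (x + y) \<le> padic_norm_rat p x + padic_norm_rat p y"
  using padic_norm_rat_ultrametric[of x y] padic_norm_rat_nonneg[of p x]
    padic_norm_rat_nonneg[of p y] by linarith

lemma padic_norm_rat_abs_diff:
  "\<bar>padic_norm_rat p x - padic_norm_rat p y\<bar> \<le> padic_norm_rat p (x - y)"
  using padic_norm_rat_triangle[of "x - y" y] padic_norm_rat_triangle[of "y - x" x]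
    padic_norm_rat_diff_commute[of x y]
  by simp

lemma padic_norm_rat_inverse: "padic_norm_rat p (inverse x) = inverse (padic_norm_rat p x)"
proof (cases "x = 0")
  case False
  then show ?thesis
    using padic_norm_rat_mult[of x "inverse x"] by (simp add: inverse_unique)
qed auto

end


subsection \<open>Cauchy sequences and null sequences\<close>

definition padic_cauchy :: "nat \<Rightarrow> (nat \<Rightarrow> rat) \<Rightarrow> bool" where
  "padic_cauchy p X \<longleftrightarrow>
    (\<forall>e>0. \<exists>N. \<forall>m\<ge>N. \<forall>n\<ge>N. padic_norm_rat p (X m - X n) < e)"

definition padic_null :: "nat \<Rightarrow> (nat \<Rightarrow> rat) \<Rightarrow> bool" where
  "padic_null p X \<longleftrightarrow> (\<lambda>n. padic_norm_rat p (X n)) \<longlonglongrightarrow> 0"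

lemma padic_null_iff: "padic_null p X \<longleftrightarrow> (\<forall>e>0. \<exists>N. \<forall>n\<ge>N. padic_norm_rat p (X n) < e)"
  by (simp add: padic_null_def LIMSEQ_iff)

lemma padic_null_le:
  assumes "padic_null p Y" "\<And>n. n \<ge> N \<Longrightarrow> padic_norm_rat p (X n) \<le> C * padic_norm_rat p (Y n)"
  shows "padic_null p X"
  unfolding padic_null_def
proof (rule tendsto_sandwich[of "\<lambda>_. 0"])
  show "\<forall>\<^sub>F n in sequentially. padic_norm_rat p (X n) \<le> C * padic_norm_rat p (Y n)"
    using assms(2) by (auto simp: eventually_sequentially)
  show "(\<lambda>n. C * padic_norm_rat p (Y n)) \<longlonglongrightarrow> 0"
    using assms(1) tendsto_mult_right_zero by (auto simp: padic_null_def)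
qed auto

lemma padic_cauchy_const [simp]: "padic_cauchy p (\<lambda>_. c)"
  by (simp add: padic_cauchy_def)

lemma padic_null_zero [simp]: "padic_null p (\<lambda>_. 0)"
  by (simp add: padic_null_def)

context
  fixes p :: nat
  assumes p: "prime p"
begin

lemma padic_null_add:
  assumes "padic_null p X" "padic_null p Y"
  shows "padic_null p (\<lambda>n. X n + Y n)"
proof -
  have "(\<lambda>n. padic_norm_rat p (X n) + padic_norm_rat p (Y n)) \<longlonglongrightarrow> 0"
    using tendsto_add[OF assms[unfolded padic_null_def]] by simp
  then show ?thesis
    unfolding padic_null_def
    by (rule tendsto_sandwich[OF _ _ tendsto_const, rotated 2])
       (auto simp: padic_norm_rat_triangle[OF p])
qed

lemma padic_null_minus: "padic_null p (\<lambda>n. - X n) \<longleftrightarrow> padic_null p X"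
  by (simp add: padic_null_def padic_norm_rat_minus[OF p])

lemma padic_null_diff_commute: "padic_null p (\<lambda>n. X n - Y n) \<longleftrightarrow> padic_null p (\<lambda>n. Y n - X n)"
  by (simp add: padic_null_def padic_norm_rat_diff_commute[OF p, of "X _"])

lemma padic_cauchy_bounded:
  assumes "padic_cauchy p X"
  obtains C where "C > 0" "\<And>n. padic_norm_rat p (X n) \<le> C"
proof -
  obtain N where N: "\<And>m n. m \<ge> N \<Longrightarrow> n \<ge> N \<Longrightarrow> padic_norm_rat p (X m - X n) < 1"
    using assms zero_less_one unfolding padic_cauchy_def by blast
  define C where "C = (\<Sum>i\<le>N. padic_norm_rat p (X i)) + 1"
  have S: "padic_norm_rat p (X n) \<le> (\<Sum>i\<le>N. padic_norm_rat p (X i))" if "n \<le> N" for n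
    using that by (intro member_le_sum) auto
  have "padic_norm_rat p (X n) \<le> C" for n
  proof (cases "n \<le> N")
    case True
    then show ?thesis using S[of n] by (simp add: C_def)
  next
    case False
    have "padic_norm_rat p (X n) \<le> padic_norm_rat p (X N) + padic_norm_rat p (X n - X N)"
      using padic_norm_rat_triangle[OF p, of "X N" "X n - X N"] by simp
    then show ?thesis using N[of n N] S[of N] False by (simp add: C_def)
  qed
  moreover have "C > 0" using sum_nonneg[of "{..N}" "\<lambda>i. padic_norm_rat p (X i)"]
    by (simp add: C_def add_nonneg_pos)
  ultimately show ?thesis using that by blast
qed

lemma padic_cauchy_add:
  assumes "padic_cauchy p X" "padic_cauchy p Y"
  shows "padic_cauchy p (\<lambda>n. X n + Y n)"
  unfolding padic_cauchy_def
proof (intro allI impI)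
  fix e :: real assume e: "e > 0"
  obtain M where M: "\<And>m n. m \<ge> M \<Longrightarrow> n \<ge> M \<Longrightarrow> padic_norm_rat p (X m - X n) < e"
    using assms(1) e unfolding padic_cauchy_def by blast
  obtain N where N: "\<And>m n. m \<ge> N \<Longrightarrow> n \<ge> N \<Longrightarrow> padic_norm_rat p (Y m - Y n) < e"
    using assms(2) e unfolding padic_cauchy_def by blast
  have "padic_norm_rat p (X m + Y m - (X n + Y n)) < e" if "m \<ge> max M N" "n \<ge> max M N" for m n
  proof -
    have "X m + Y m - (X n + Y n) = (X m - X n) + (Y m - Y n)" by simp
    then show ?thesis
      using padic_norm_rat_ultrametric[OF p, of "X m - X n" "Y m - Y n"] M[of m n] N[of m n] that
      by (simp only:) (auto simp: max_def split: if_splits)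
  qed
  then show "\<exists>N. \<forall>m\<ge>N. \<forall>n\<ge>N. padic_norm_rat p (X m + Y m - (X n + Y n)) < e" by blast
qed

lemma padic_cauchy_minus:
  assumes "padic_cauchy p X"
  shows "padic_cauchy p (\<lambda>n. - X n)"
proof -
  have "padic_norm_rat p (- X m - - X n) = padic_norm_rat p (X m - X n)" for m n
    using padic_norm_rat_minus[OF p, of "X m - X n"] by simp
  then show ?thesis using assms unfolding padic_cauchy_def by simp
qed

lemma padic_cauchy_mult:
  assumes "padic_cauchy p X" "padic_cauchy p Y"
  shows "padic_cauchy p (\<lambda>n. X n * Y n)"
  unfolding padic_cauchy_def
proof (intro allI impI)
  fix e :: real assume e: "e > 0"
  obtain A where A: "A > 0" "\<And>n. padic_norm_rat p (X n) \<le> A"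
    using padic_cauchy_bounded[OF assms(1)] by blast
  obtain B where B: "B > 0" "\<And>n. padic_norm_rat p (Y n) \<le> B"
    using padic_cauchy_bounded[OF assms(2)] by blast
  have eA: "e / A > 0" and eB: "e / B > 0" using e A B by auto
  obtain M where M: "\<And>m n. m \<ge> M \<Longrightarrow> n \<ge> M \<Longrightarrow> padic_norm_rat p (X m - X n) < e / B"
    using assms(1) eB unfolding padic_cauchy_def by blast
  obtain N where N: "\<And>m n. m \<ge> N \<Longrightarrow> n \<ge> N \<Longrightarrow> padic_norm_rat p (Y m - Y n) < e / A"
    using assms(2) eA unfolding padic_cauchy_def by blast
  have "padic_norm_rat p (X m * Y m - X n * Y n) < e" if mn: "m \<ge> max M N" "n \<ge> max M N" for m n
  proof -
    have eq: "X m * Y m - X n * Y n = X m * (Y m - Y n) + (X m - X n) * Y n"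
      by (simp add: algebra_simps)
    have "padic_norm_rat p (X m * (Y m - Y n)) \<le> A * padic_norm_rat p (Y m - Y n)"
      by (simp add: padic_norm_rat_mult[OF p] A mult_right_mono)
    also have "\<dots> < e"
      using N[of m n] mn A by (simp add: field_simps)
    finally have 1: "padic_norm_rat p (X m * (Y m - Y n)) < e" .
    have "padic_norm_rat p ((X m - X n) * Y n) \<le> padic_norm_rat p (X m - X n) * B"
      by (simp add: padic_norm_rat_mult[OF p] B mult_left_mono)
    also have "\<dots> < e"
      using M[of m n] mn B by (simp add: field_simps)
    finally have 2: "padic_norm_rat p ((X m - X n) * Y n) < e" .
    show ?thesis
      unfolding eq using padic_norm_rat_ultrametric[OF p, of "X m * (Y m - Y n)" "(X m - X n) * Y n"] 1 2
      by (auto simp: max_def split: if_splits)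
  qed
  then show "\<exists>N. \<forall>m\<ge>N. \<forall>n\<ge>N. padic_norm_rat p (X m * Y m - X n * Y n) < e" by blast
qed

lemma padic_null_mult_bounded:
  assumes "\<And>n. padic_norm_rat p (X n) \<le> C" "padic_null p Y"
  shows "padic_null p (\<lambda>n. X n * Y n)"
  by (rule padic_null_le[OF assms(2), of 0 _ C])
     (simp add: padic_norm_rat_mult[OF p] assms mult_right_mono)

lemma padic_not_null_away:
  assumes X: "padic_cauchy p X" and nn: "\<not> padic_null p X"
  obtains c N where "c > 0" "\<And>n. n \<ge> N \<Longrightarrow> padic_norm_rat p (X n) \<ge> c"
proof -
  obtain e where e: "e > 0" "\<And>N. \<exists>n\<ge>N. padic_norm_rat p (X n) \<ge> e"
    using nn unfolding padic_null_iff by (auto simp: not_less)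
  obtain N where N: "\<And>m n. m \<ge> N \<Longrightarrow> n \<ge> N \<Longrightarrow> padic_norm_rat p (X m - X n) < e / 2"
    using X e(1) unfolding padic_cauchy_def by (meson half_gt_zero)
  obtain m where m: "m \<ge> N" "padic_norm_rat p (X m) \<ge> e" using e(2) by blast
  have "padic_norm_rat p (X n) \<ge> e / 2" if "n \<ge> N" for n
    using padic_norm_rat_abs_diff[OF p, of "X m" "X n"] N[OF m(1) that] m(2) by linarith
  then show ?thesis using that[of "e / 2" N] e(1) by auto
qed

lemma padic_norm_rat_inverse_diff:
  assumes "x \<noteq> 0" "y \<noteq> 0"
  shows "padic_norm_rat p (inverse x - inverse y)
    = inverse (padic_norm_rat p x) * padic_norm_rat p (x - y) * inverse (padic_norm_rat p y)"
  using assms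
  by (simp add: inverse_diff_inverse padic_norm_rat_mult[OF p] padic_norm_rat_minus[OF p]
      padic_norm_rat_inverse[OF p])

lemma padic_inverse_bound:
  assumes "c > 0" "padic_norm_rat p x \<ge> c" "d > 0" "padic_norm_rat p y \<ge> d"
  shows "padic_norm_rat p (inverse x - inverse y) \<le> inverse (c * d) * padic_norm_rat p (x - y)"
proof -
  have nz: "x \<noteq> 0" "y \<noteq> 0" using assms by auto
  have "inverse (padic_norm_rat p x) * inverse (padic_norm_rat p y) \<le> inverse c * inverse d"
    using assms by (intro mult_mono le_imp_inverse_le) auto
  then have "inverse (padic_norm_rat p x) * inverse (padic_norm_rat p y) * padic_norm_rat p (x - y)
      \<le> inverse c * inverse d * padic_norm_rat p (x - y)"
    by (intro mult_right_mono) auto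
  then show ?thesis
    unfolding padic_norm_rat_inverse_diff[OF nz] by (simp add: mult_ac)
qed

lemma padic_cauchy_inverse:
  assumes X: "padic_cauchy p X" and nn: "\<not> padic_null p X"
  shows "padic_cauchy p (\<lambda>n. inverse (X n))"
  unfolding padic_cauchy_def
proof (intro allI impI)
  fix e :: real assume e: "e > 0"
  obtain c N where c: "c > 0" "\<And>n. n \<ge> N \<Longrightarrow> padic_norm_rat p (X n) \<ge> c"
    using padic_not_null_away[OF assms] by blast
  have "e * (c * c) > 0" using e c by simp
  then obtain M where M: "\<And>m n. m \<ge> M \<Longrightarrow> n \<ge> M \<Longrightarrow> padic_norm_rat p (X m - X n) < e * (c * c)"
    using X unfolding padic_cauchy_def by blast
  have "padic_norm_rat p (inverse (X m) - inverse (X n)) < e" if "m \<ge> max M N" "n \<ge> max M N" for m n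
  proof -
    have "padic_norm_rat p (inverse (X m) - inverse (X n))
        \<le> inverse (c * c) * padic_norm_rat p (X m - X n)"
      using c that by (intro padic_inverse_bound) auto
    also have "\<dots> < inverse (c * c) * (e * (c * c))"
      using M[of m n] that c(1) by (intro mult_strict_left_mono) auto
    also have "\<dots> = e" using c(1) by (simp add: field_simps)
    finally show ?thesis .
  qed
  then show "\<exists>N. \<forall>m\<ge>N. \<forall>n\<ge>N. padic_norm_rat p (inverse (X m) - inverse (X n)) < e" by blast
qed

lemma padic_null_inverse_diff:
  assumes "padic_cauchy p X" "\<not> padic_null p X" "padic_cauchy p Y" "\<not> padic_null p Y"
    and XY: "padic_null p (\<lambda>n. X n - Y n)"
  shows "padic_null p (\<lambda>n. inverse (X n) - inverse (Y n))"
proof -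
  obtain c M where c: "c > 0" "\<And>n. n \<ge> M \<Longrightarrow> padic_norm_rat p (X n) \<ge> c"
    using padic_not_null_away[OF assms(1,2)] by blast
  obtain d N where d: "d > 0" "\<And>n. n \<ge> N \<Longrightarrow> padic_norm_rat p (Y n) \<ge> d"
    using padic_not_null_away[OF assms(3,4)] by blast
  show ?thesis
    by (rule padic_null_le[OF XY, of "max M N" _ "inverse (c * d)"])
       (rule padic_inverse_bound, use c d in auto)
qed

lemma padic_norm_rat_convergent:
  assumes "padic_cauchy p X"
  shows "convergent (\<lambda>n. padic_norm_rat p (X n))"
proof -
  have "Cauchy (\<lambda>n. padic_norm_rat p (X n))"
    unfolding Cauchy_def dist_real_def
    using assms padic_norm_rat_abs_diff[OF p] unfolding padic_cauchy_def
    by (meson le_less_trans)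
  then show ?thesis by (simp add: Cauchy_convergent_iff)
qed

end


subsection \<open>The p-adic numbers as a quotient\<close>

text \<open>The prime \<open>p\<close> is the cardinality of the type argument; every prime is the cardinality of
  some type, so a statement about \<open>'p padic\<close> covers all primes. The field is the ring of
  p-adic Cauchy sequences of rationals modulo the ideal of null sequences.\<close>

class prime_card =
  assumes prime_card: "prime CARD('a)"

typedef ('p::prime_card) padic_seq = "{X. padic_cauchy CARD('p) X}"
  by (rule exI[of _ "\<lambda>_. 0"]) simp

setup_lifting type_definition_padic_seq

instantiation padic_seq :: (prime_card) comm_ring_1
begin

lift_definition zero_padic_seq :: "'a padic_seq" is "\<lambda>_. 0" by simp

lift_definition one_padic_seq :: "'a padic_seq" is "\<lambda>_. 1" by simp

lift_definition plus_padic_seq :: "'a padic_seq \<Rightarrow> 'a padic_seq \<Rightarrow> 'a padic_seq"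
  is "\<lambda>X Y n. X n + Y n" by (rule padic_cauchy_add[OF prime_card])

lift_definition uminus_padic_seq :: "'a padic_seq \<Rightarrow> 'a padic_seq"
  is "\<lambda>X n. - X n" by (rule padic_cauchy_minus[OF prime_card])

definition minus_padic_seq :: "'a padic_seq \<Rightarrow> 'a padic_seq \<Rightarrow> 'a padic_seq" where
  "minus_padic_seq X Y = X + - Y"

lift_definition times_padic_seq :: "'a padic_seq \<Rightarrow> 'a padic_seq \<Rightarrow> 'a padic_seq"
  is "\<lambda>X Y n. X n * Y n" by (rule padic_cauchy_mult[OF prime_card])

instance
  by standard
    (unfold minus_padic_seq_def, (transfer; auto simp: algebra_simps fun_eq_iff)+)

end

lift_definition null_seq :: "'p::prime_card padic_seq \<Rightarrow> bool" is "padic_null CARD('p)" .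

lift_definition inverse_seq :: "'p::prime_card padic_seq \<Rightarrow> 'p padic_seq"
  is "\<lambda>X. if padic_null CARD('p) X then (\<lambda>_. 0) else (\<lambda>n. inverse (X n))"
  by (simp add: padic_cauchy_inverse[OF prime_card])

lift_definition norm_seq :: "'p::prime_card padic_seq \<Rightarrow> real"
  is "\<lambda>X. lim (\<lambda>n. padic_norm_rat CARD('p) (X n))" .

lift_definition const_seq :: "rat \<Rightarrow> 'p::prime_card padic_seq" is "\<lambda>q _. q" by simp

lemma Rep_padic_seq_diff: "Rep_padic_seq (X - Y) = (\<lambda>n. Rep_padic_seq X n - Rep_padic_seq Y n)"
  unfolding minus_padic_seq_def plus_padic_seq.rep_eq uminus_padic_seq.rep_eq by simp

lemma norm_seq_LIMSEQ:
  "(\<lambda>n. padic_norm_rat CARD('p) (Rep_padic_seq X n)) \<longlonglongrightarrow> norm_seq (X :: 'p::prime_card padic_seq)"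
proof -
  have "convergent (\<lambda>n. padic_norm_rat CARD('p) (Rep_padic_seq X n))"
    using Rep_padic_seq[of X] by (intro padic_norm_rat_convergent[OF prime_card]) simp
  then show ?thesis
    unfolding norm_seq.rep_eq by (simp only: convergent_LIMSEQ_iff)
qed

lemma norm_seq_unique:
  "(\<lambda>n. padic_norm_rat CARD('p) (Rep_padic_seq X n)) \<longlonglongrightarrow> c \<Longrightarrow> norm_seq (X :: 'p::prime_card padic_seq) = c"
  by (rule LIMSEQ_unique[OF norm_seq_LIMSEQ])

lemma norm_seq_nonneg [simp]: "norm_seq X \<ge> 0"
  by (rule LIMSEQ_le_const[OF norm_seq_LIMSEQ]) auto

lemma norm_seq_eq_0_iff: "norm_seq X = 0 \<longleftrightarrow> null_seq X"
  unfolding null_seq.rep_eq padic_null_def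
  using norm_seq_LIMSEQ[of X] norm_seq_unique[of X 0] by metis

lemma norm_seq_mult: "norm_seq (X * Y) = norm_seq X * norm_seq Y"
  by (rule norm_seq_unique)
     (simp add: times_padic_seq.rep_eq padic_norm_rat_mult[OF prime_card]
       tendsto_mult norm_seq_LIMSEQ)

lemma norm_seq_minus [simp]: "norm_seq (- X) = norm_seq X"
  by (rule norm_seq_unique)
     (simp add: uminus_padic_seq.rep_eq padic_norm_rat_minus[OF prime_card] norm_seq_LIMSEQ)

lemma norm_seq_ultrametric: "norm_seq (X + Y) \<le> max (norm_seq X) (norm_seq Y)"
  by (rule LIMSEQ_le[OF norm_seq_LIMSEQ tendsto_max[OF norm_seq_LIMSEQ norm_seq_LIMSEQ]])
     (auto simp: plus_padic_seq.rep_eq padic_norm_rat_ultrametric[OF prime_card])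

lemma norm_seq_const: "norm_seq (const_seq q :: 'p padic_seq) = padic_norm_rat CARD('p::prime_card) q"
  by (rule norm_seq_unique) (simp add: const_seq.rep_eq)

lemma null_seq_0 [simp]: "null_seq 0"
  by transfer simp

lemma null_seq_add: "null_seq X \<Longrightarrow> null_seq Y \<Longrightarrow> null_seq (X + Y)"
  using norm_seq_ultrametric[of X Y] norm_seq_nonneg[of "X + Y"]
  by (simp flip: norm_seq_eq_0_iff)

lemma null_seq_minus [simp]: "null_seq (- X) \<longleftrightarrow> null_seq X"
  by (simp flip: norm_seq_eq_0_iff)

lemma null_seq_mult: "null_seq X \<Longrightarrow> null_seq (Y * X)"
  by (simp add: norm_seq_mult flip: norm_seq_eq_0_iff)

lemma not_null_seq_1 [simp]: "\<not> null_seq (1 :: 'p::prime_card padic_seq)"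
  by transfer (simp add: padic_null_def padic_norm_rat_1[OF prime_card] LIMSEQ_const_iff)

lemma null_seq_diff_cong: "null_seq (X - Y) \<Longrightarrow> null_seq X \<longleftrightarrow> null_seq Y"
  using null_seq_add[of "X - Y" Y] null_seq_add[of "- (X - Y)" X] null_seq_minus[of "X - Y"] by auto

lemma norm_seq_cong:
  assumes "null_seq (X - Y)"
  shows "norm_seq X = norm_seq Y"
proof (rule antisym)
  have "norm_seq (X - Y) = 0" "norm_seq (- (X - Y)) = 0"
    using assms by (simp_all only: norm_seq_minus norm_seq_eq_0_iff)
  then show "norm_seq X \<le> norm_seq Y" "norm_seq Y \<le> norm_seq X"
    using norm_seq_ultrametric[of "X - Y" Y] norm_seq_ultrametric[of "- (X - Y)" X]
    by simp_all
qed

lemma null_seq_inverse: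
  "\<not> null_seq X \<Longrightarrow> null_seq (inverse_seq X * X - 1)"
proof -
  assume nn: "\<not> null_seq X"
  obtain c N where c: "c > 0" "\<And>n. n \<ge> N \<Longrightarrow> padic_norm_rat CARD('a) (Rep_padic_seq X n) \<ge> c"
    using padic_not_null_away[OF prime_card[where 'a='a]] nn Rep_padic_seq[of X]
    unfolding null_seq.rep_eq by blast
  have "Rep_padic_seq X n \<noteq> 0" if "n \<ge> N" for n
    using c(2)[OF that] c(1) by auto
  then have "Rep_padic_seq (inverse_seq X * X - 1) n = 0" if "n \<ge> N" for n
    using that nn
    by (simp add: Rep_padic_seq_diff times_padic_seq.rep_eq one_padic_seq.rep_eq
        inverse_seq.rep_eq null_seq.rep_eq)
  then show ?thesis
    unfolding null_seq.rep_eq padic_null_iff by (intro allI impI exI[of _ N]) auto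
qed

lemma null_seq_inverse_cong:
  assumes "null_seq (X - Y)"
  shows "null_seq (inverse_seq X - inverse_seq Y)"
proof (cases "null_seq X")
  case True
  then have "null_seq Y" using null_seq_diff_cong[OF assms] by simp
  moreover have "inverse_seq Z = 0" if "null_seq Z" for Z :: "'a padic_seq"
    using that by transfer simp
  ultimately have "inverse_seq X - inverse_seq Y = 0" using True by simp
  then show ?thesis by simp
next
  case False
  then have "\<not> null_seq Y" using null_seq_diff_cong[OF assms] by simp
  with False assms show ?thesis
    using padic_null_inverse_diff[OF prime_card[where 'a='a], of "Rep_padic_seq X" "Rep_padic_seq Y"]
      Rep_padic_seq[of X] Rep_padic_seq[of Y]
    by (simp add: null_seq.rep_eq Rep_padic_seq_diff inverse_seq.rep_eq)
qed

definition padic_eq :: "'p::prime_card padic_seq \<Rightarrow> 'p padic_seq \<Rightarrow> bool" where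
  "padic_eq X Y \<longleftrightarrow> null_seq (X - Y)"

lemma equivp_padic_eq: "equivp padic_eq"
proof (rule equivpI)
  show "reflp padic_eq" by (simp add: reflp_def padic_eq_def)
  show "symp padic_eq"
    using null_seq_minus[of "_ - _"] by (fastforce simp: symp_def padic_eq_def)
  show "transp padic_eq"
    unfolding transp_def padic_eq_def using null_seq_add by fastforce
qed

quotient_type 'p padic = "'p::prime_card padic_seq" / padic_eq
  by (rule equivp_padic_eq)

instantiation padic :: (prime_card) field
begin

lift_definition zero_padic :: "'a padic" is 0 .

lift_definition one_padic :: "'a padic" is 1 .

lift_definition plus_padic :: "'a padic \<Rightarrow> 'a padic \<Rightarrow> 'a padic" is "(+)"
  unfolding padic_eq_def using null_seq_add by (metis add_diff_add)

lift_definition uminus_padic :: "'a padic \<Rightarrow> 'a padic" is uminus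
  unfolding padic_eq_def using null_seq_minus by (metis minus_diff_minus)

definition minus_padic :: "'a padic \<Rightarrow> 'a padic \<Rightarrow> 'a padic" where
  "minus_padic x y = x + - y"

lift_definition times_padic :: "'a padic \<Rightarrow> 'a padic \<Rightarrow> 'a padic" is "(*)"
proof -
  fix X X' Y Y' :: "'a padic_seq"
  assume "padic_eq X X'" "padic_eq Y Y'"
  then have "null_seq (X * (Y - Y') + Y' * (X - X'))"
    unfolding padic_eq_def by (intro null_seq_add null_seq_mult)
  then show "padic_eq (X * Y) (X' * Y')"
    unfolding padic_eq_def by (simp add: algebra_simps)
qed

lift_definition inverse_padic :: "'a padic \<Rightarrow> 'a padic" is inverse_seq
  unfolding padic_eq_def by (rule null_seq_inverse_cong)

definition divide_padic :: "'a padic \<Rightarrow> 'a padic \<Rightarrow> 'a padic" where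
  "divide_padic x y = x * inverse y"

instance
proof
  fix a b c :: "'a padic"
  show "a + b + c = a + (b + c)" "a + b = b + a" "0 + a = a" "- a + a = 0"
    "a * b * c = a * (b * c)" "a * b = b * a" "1 * a = a" "(a + b) * c = a * c + b * c"
    by (transfer; simp add: padic_eq_def algebra_simps)+
  show "a - b = a + - b" "a div b = a * inverse b"
    by (rule minus_padic_def divide_padic_def)+
  show "(0 :: 'a padic) \<noteq> 1"
    by transfer (simp add: padic_eq_def)
  show "a \<noteq> 0 \<Longrightarrow> inverse a * a = 1"
    by transfer (simp add: padic_eq_def null_seq_inverse)
  show "inverse (0 :: 'a padic) = 0"
    by transfer (simp add: padic_eq_def, transfer, simp)
qed

end

lift_definition padic_norm :: "'p::prime_card padic \<Rightarrow> real" is norm_seq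
  unfolding padic_eq_def by (rule norm_seq_cong)

lemma padic_norm_nonneg [simp]: "padic_norm (x :: 'p::prime_card padic) \<ge> 0"
  by transfer simp

lemma padic_norm_eq_0_iff [simp]: "padic_norm (x :: 'p::prime_card padic) = 0 \<longleftrightarrow> x = 0"
  by transfer (simp add: padic_eq_def norm_seq_eq_0_iff)

lemma padic_norm_minus [simp]: "padic_norm (- x :: 'p::prime_card padic) = padic_norm x"
  by transfer simp

lemma padic_norm_mult: "padic_norm (x * y :: 'p::prime_card padic) = padic_norm x * padic_norm y"
  by transfer (rule norm_seq_mult)

lemma padic_norm_ultrametric:
  "padic_norm (x + y :: 'p::prime_card padic) \<le> max (padic_norm x) (padic_norm y)"
  by transfer (rule norm_seq_ultrametric)

instantiation padic :: (prime_card) "metric_space"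
begin

definition dist_padic :: "'a padic \<Rightarrow> 'a padic \<Rightarrow> real" where
  "dist_padic x y = padic_norm (x - y)"

definition uniformity_padic :: "('a padic \<times> 'a padic) filter" where
  "uniformity_padic = (INF e\<in>{0<..}. principal {(x, y). dist x y < e})"

definition open_padic :: "'a padic set \<Rightarrow> bool" where
  "open_padic U \<longleftrightarrow> (\<forall>x\<in>U. \<forall>\<^sub>F (x', y) in uniformity. x' = x \<longrightarrow> y \<in> U)"

instance
proof
  fix x y z :: "'a padic"
  show "dist x y = 0 \<longleftrightarrow> x = y" by (simp add: dist_padic_def)
  have "padic_norm (x - y) \<le> max (padic_norm (x - z)) (padic_norm (z - y))"
    using padic_norm_ultrametric[of "x - z" "z - y"] by simp
  also have "\<dots> \<le> padic_norm (x - z) + padic_norm (z - y)"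
    by simp
  also have "padic_norm (z - y) = padic_norm (y - z)"
    using padic_norm_minus[of "z - y"] by simp
  finally show "dist x y \<le> dist x z + dist y z"
    by (simp add: dist_padic_def)
qed (rule uniformity_padic_def open_padic_def)+

end

lift_definition padic_of_rat :: "rat \<Rightarrow> 'p::prime_card padic" is const_seq .

lemma padic_of_rat_simps:
  "padic_of_rat 0 = (0 :: 'p::prime_card padic)"
  "padic_of_rat 1 = (1 :: 'p::prime_card padic)"
  "padic_of_rat (x + y) = (padic_of_rat x + padic_of_rat y :: 'p::prime_card padic)"
  "padic_of_rat (- x) = (- padic_of_rat x :: 'p::prime_card padic)"
  "padic_of_rat (x * y) = (padic_of_rat x * padic_of_rat y :: 'p::prime_card padic)"
proof -
  have *: "const_seq 0 = (0 :: 'p::prime_card padic_seq)"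
      "const_seq 1 = (1 :: 'p::prime_card padic_seq)"
      "const_seq (x + y) = (const_seq x + const_seq y :: 'p::prime_card padic_seq)"
      "const_seq (- x) = (- const_seq x :: 'p::prime_card padic_seq)"
      "const_seq (x * y) = (const_seq x * const_seq y :: 'p::prime_card padic_seq)"
    by (transfer; simp)+
  show "padic_of_rat 0 = (0 :: 'p::prime_card padic)"
    "padic_of_rat 1 = (1 :: 'p::prime_card padic)"
    "padic_of_rat (x + y) = (padic_of_rat x + padic_of_rat y :: 'p::prime_card padic)"
    "padic_of_rat (- x) = (- padic_of_rat x :: 'p::prime_card padic)"
    "padic_of_rat (x * y) = (padic_of_rat x * padic_of_rat y :: 'p::prime_card padic)"
    by (simp_all add: * padic_of_rat.abs_eq zero_padic_def one_padic_def plus_padic.abs_eq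
        uminus_padic.abs_eq times_padic.abs_eq)
qed

lemma padic_norm_padic_of_rat:
  "padic_norm (padic_of_rat q :: 'p padic) = padic_norm_rat CARD('p::prime_card) q"
  by transfer (rule norm_seq_const)

lemma padic_of_rat_of_nat: "padic_of_rat (of_nat n) = (of_nat n :: 'p::prime_card padic)"
  by (induction n) (simp_all add: padic_of_rat_simps)

lemma padic_of_rat_of_int: "padic_of_rat (of_int n) = (of_int n :: 'p::prime_card padic)"
  by (cases n rule: int_cases2) (simp_all add: padic_of_rat_simps padic_of_rat_of_nat)

instance padic :: (prime_card) field_char_0
proof
  show "inj (of_nat :: nat \<Rightarrow> 'a padic)"
  proof (rule injI)
    fix m n :: nat
    assume "of_nat m = (of_nat n :: 'a padic)"
    then have "padic_of_rat (of_nat m + - of_nat n) = (0 :: 'a padic)"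
      unfolding padic_of_rat_simps padic_of_rat_of_nat by simp
    then have "padic_norm_rat CARD('a) (of_nat m + - of_nat n) = 0"
      by (metis padic_norm_padic_of_rat padic_norm_eq_0_iff)
    then show "m = n"
      by (simp add: padic_norm_rat_eq_0_iff[OF prime_card])
  qed
qed

lemma padic_of_rat_eq_of_rat: "padic_of_rat q = (of_rat q :: 'p::prime_card padic)"
proof -
  obtain a b where q: "q = of_int a / of_int b" "b \<noteq> 0" by (rule rat_fraction)
  then have "q * of_int b = of_int a" by simp
  then have "padic_of_rat q * of_int b = (of_int a :: 'p padic)"
    by (metis padic_of_rat_simps(5) padic_of_rat_of_int)
  then have "padic_of_rat q = (of_int a / of_int b :: 'p padic)"
    using q(2) by (simp add: nonzero_eq_divide_eq)
  then show ?thesis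
    using q(1) by (simp add: of_rat_divide)
qed

theorem padic_norm_of_rat:
  "padic_norm (of_rat q :: 'p padic) = padic_norm_rat CARD('p::prime_card) q"
  using padic_norm_padic_of_rat padic_of_rat_eq_of_rat by metis

text \<open>The rationals are dense, and the space is complete: it is the completion of the
  rationals with respect to the p-adic norm.\<close>

lemma padic_eventually_close:
  fixes X :: "'p::prime_card padic_seq"
  assumes "\<And>m n. m \<ge> N \<Longrightarrow> n \<ge> N \<Longrightarrow>
    padic_norm_rat CARD('p) (Rep_padic_seq X m - Rep_padic_seq X n) < e" and "n \<ge> N"
  shows "padic_norm (abs_padic X - of_rat (Rep_padic_seq X n)) \<le> e"
proof -
  have "norm_seq (X - const_seq (Rep_padic_seq X n)) \<le> e"
    by (rule LIMSEQ_le_const2[OF norm_seq_LIMSEQ])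
       (use assms in \<open>auto simp: Rep_padic_seq_diff const_seq.rep_eq intro!: exI[of _ N] less_imp_le\<close>)
  moreover have "abs_padic X - of_rat (Rep_padic_seq X n) = abs_padic (X - const_seq (Rep_padic_seq X n))"
    unfolding minus_padic_def minus_padic_seq_def
    by (simp only: plus_padic.abs_eq uminus_padic.abs_eq padic_of_rat.abs_eq flip: padic_of_rat_eq_of_rat)
  ultimately show ?thesis by (simp add: padic_norm.abs_eq)
qed

theorem padic_rat_dense:
  fixes x :: "'p::prime_card padic"
  assumes "e > 0"
  shows "\<exists>q. padic_norm (x - of_rat q) < e"
proof -
  have "\<exists>X. x = abs_padic X" by (induct x rule: padic.abs_induct) blast
  then obtain X where x: "x = abs_padic X" ..
  have "padic_cauchy CARD('p) (Rep_padic_seq X)" using Rep_padic_seq[of X] by simp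
  moreover have "e / 2 > 0" using assms by simp
  ultimately obtain N where N: "\<And>m n. m \<ge> N \<Longrightarrow> n \<ge> N \<Longrightarrow>
      padic_norm_rat CARD('p) (Rep_padic_seq X m - Rep_padic_seq X n) < e / 2"
    unfolding padic_cauchy_def by blast
  have "padic_norm (x - of_rat (Rep_padic_seq X N)) \<le> e / 2"
    unfolding x by (rule padic_eventually_close[OF N]) auto
  with assms have "padic_norm (x - of_rat (Rep_padic_seq X N)) < e" by linarith
  then show ?thesis by blast
qed

instance padic :: (prime_card) complete_space
proof
  fix X :: "nat \<Rightarrow> 'a padic"
  assume X: "Cauchy X"
  have "\<exists>q. dist (X n) (of_rat q) < inverse (real (Suc n))" for n
    using padic_rat_dense[of "inverse (real (Suc n))" "X n"] by (simp add: dist_padic_def)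
  then obtain q where q: "\<And>n. dist (X n) (of_rat (q n)) < inverse (real (Suc n))"
    by metis
  have lim: "(\<lambda>n. dist (X n) (of_rat (q n))) \<longlonglongrightarrow> 0"
    by (rule tendsto_sandwich[OF _ _ tendsto_const LIMSEQ_inverse_real_of_nat])
       (use q in \<open>auto intro!: always_eventually less_imp_le simp del: of_nat_Suc\<close>)
  have "\<exists>N. \<forall>m\<ge>N. \<forall>n\<ge>N. dist (of_rat (q m) :: 'a padic) (of_rat (q n)) < e"
    if e: "e > 0" for e :: real
  proof -
    have e3: "e / 3 > 0" using e by simp
    obtain M where M: "\<And>m n. m \<ge> M \<Longrightarrow> n \<ge> M \<Longrightarrow> dist (X m) (X n) < e / 3"
      using X e3 unfolding Cauchy_def by blast
    obtain N where N: "\<And>n. n \<ge> N \<Longrightarrow> dist (X n) (of_rat (q n)) < e / 3"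
      using LIMSEQ_D[OF lim e3] by auto
    have "dist (of_rat (q m) :: 'a padic) (of_rat (q n)) < e" if "m \<ge> max M N" "n \<ge> max M N" for m n
    proof -
      have "dist (of_rat (q m) :: 'a padic) (of_rat (q n))
          \<le> dist (X m) (of_rat (q m)) + dist (X m) (X n) + dist (X n) (of_rat (q n))"
        using dist_triangle3[of "of_rat (q m)" "of_rat (q n)" "X m"]
          dist_triangle[of "X m" "of_rat (q n)" "X n"] by linarith
      then show ?thesis using M[of m n] N[of m] N[of n] that by simp
    qed
    then show ?thesis by blast
  qed
  then have q_cauchy: "padic_cauchy CARD('a) q"
    by (simp add: padic_cauchy_def dist_padic_def padic_norm_of_rat flip: of_rat_diff)
  define L :: "'a padic" where "L = abs_padic (Abs_padic_seq q)"
  have Rep: "Rep_padic_seq (Abs_padic_seq q :: 'a padic_seq) = q"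
    using q_cauchy by (simp add: Abs_padic_seq_inverse)
  have "(\<lambda>n. of_rat (q n)) \<longlonglongrightarrow> L"
    unfolding lim_sequentially
  proof (intro allI impI)
    fix e :: real assume e: "e > 0"
    then have "e / 2 > 0" by simp
    then obtain N where N: "\<And>m n. m \<ge> N \<Longrightarrow> n \<ge> N \<Longrightarrow> padic_norm_rat CARD('a) (q m - q n) < e / 2"
      using q_cauchy unfolding padic_cauchy_def by blast
    have "dist (of_rat (q n)) L < e" if "n \<ge> N" for n
    proof -
      have "padic_norm (L - of_rat (q n)) \<le> e / 2"
        using padic_eventually_close[of N "Abs_padic_seq q :: 'a padic_seq" "e / 2" n] N that
        by (simp add: Rep L_def)
      moreover have "dist (of_rat (q n)) L = padic_norm (L - of_rat (q n))"
        unfolding dist_padic_def[symmetric] by (rule dist_commute)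
      ultimately show ?thesis using e by simp
    qed
    then show "\<exists>N. \<forall>n\<ge>N. dist (of_rat (q n)) L < e" by blast
  qed
  then have "(\<lambda>n. dist (of_rat (q n)) L) \<longlonglongrightarrow> 0"
    by (rule tendsto_dist_iff[THEN iffD1])
  then have "(\<lambda>n. dist (X n) (of_rat (q n)) + dist (of_rat (q n)) L) \<longlonglongrightarrow> 0"
    using tendsto_add[OF lim, of "\<lambda>n. dist (of_rat (q n)) L" 0] by simp
  then have "(\<lambda>n. dist (X n) L) \<longlonglongrightarrow> 0"
    by (rule tendsto_sandwich[OF _ _ tendsto_const, rotated 2]) (auto simp: dist_triangle)
  then have "X \<longlonglongrightarrow> L" by (rule tendsto_dist_iff[THEN iffD2])
  then show "convergent X" by (auto simp: convergent_def)
qed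


text \<open>Meaningful for \<open>padic_norm x < p powr (- 1 / (p - 1))\<close> only, where the series converges.\<close>

definition padic_exp :: "'p::prime_card padic \<Rightarrow> 'p padic" where
  "padic_exp x = (\<Sum>n. x ^ n / fact n)"


section \<open>The semi-infinite Cayley tree\<close>

text \<open>A vertex is the list of child indices (each below \<open>k\<close>) on the way from it to the root
  \<open>[]\<close>. Each undirected edge is represented once, as the pair oriented away from the root.\<close>

type_synonym vertex = "nat list"

definition tree_vertices :: "nat \<Rightarrow> vertex set" where
  "tree_vertices k = {x. set x \<subseteq> {..<k}}"

definition tree_edges :: "nat \<Rightarrow> (vertex \<times> vertex) set" where
  "tree_edges k = {(x, i # x) | x i. x \<in> tree_vertices k \<and> i < k}"

definition tree_dist :: "nat \<Rightarrow> vertex \<Rightarrow> vertex \<Rightarrow> nat" where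
  "tree_dist k x y = (LEAST n. (x, y) \<in> (tree_edges k \<union> (tree_edges k)\<inverse>) ^^ n)"

definition tree_sphere :: "nat \<Rightarrow> nat \<Rightarrow> vertex set" where
  "tree_sphere k n = {x \<in> tree_vertices k. tree_dist k x [] = n}"

definition tree_ball :: "nat \<Rightarrow> nat \<Rightarrow> vertex set" where
  "tree_ball k n = (\<Union>m\<le>n. tree_sphere k m)"

definition ball_edges :: "nat \<Rightarrow> nat \<Rightarrow> (vertex \<times> vertex) set" where
  "ball_edges k n = {(x, y) \<in> tree_edges k. x \<in> tree_ball k n \<and> y \<in> tree_ball k n}"

definition successors :: "nat \<Rightarrow> vertex \<Rightarrow> vertex set" where
  "successors k x = {y \<in> tree_sphere k (tree_dist k x [] + 1). tree_dist k x y = 1}"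

text \<open>Ordered so that the first component is the one closer to the root; thus each unordered
  pair of prolonged next-nearest neighbors occurs once.\<close>

definition prolonged_neighbors :: "nat \<Rightarrow> (vertex \<times> vertex) set" where
  "prolonged_neighbors k =
    {(x, y). tree_dist k x y = 2 \<and> (\<exists>m\<ge>2. x \<in> tree_sphere k (m - 2) \<and> y \<in> tree_sphere k m)}"


section \<open>The Ising-Vannimenus model\<close>

definition configs :: "vertex set \<Rightarrow> (vertex \<Rightarrow> int) set" where
  "configs A = A \<rightarrow>\<^sub>E {-1, 1}"

definition hamiltonian ::
  "nat \<Rightarrow> 'p::prime_card padic \<Rightarrow> 'p padic \<Rightarrow> nat \<Rightarrow> (vertex \<Rightarrow> int) \<Rightarrow> 'p padic" where
  "hamiltonian k J J1 n \<sigma> =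
    J * (\<Sum>(x, y)\<in>ball_edges k n. of_int (\<sigma> x * \<sigma> y))
    + J1 * (\<Sum>(x, y)\<in>{(x, y) \<in> prolonged_neighbors k. x \<in> tree_ball k n \<and> y \<in> tree_ball k n}.
              of_int (\<sigma> x * \<sigma> y))"

text \<open>A boundary field assigns to the edge from \<open>x\<close> to its successor \<open>y\<close> the four numbers
  \<open>h x y s t\<close>, where \<open>s, t \<in> {-1, 1}\<close> are the spins at \<open>x\<close> and \<open>y\<close>.\<close>

type_synonym 'p boundary_field = "vertex \<Rightarrow> vertex \<Rightarrow> int \<Rightarrow> int \<Rightarrow> 'p padic"

definition gibbs_weight ::
  "nat \<Rightarrow> 'p::prime_card padic \<Rightarrow> 'p padic \<Rightarrow> 'p boundary_field \<Rightarrow> nat \<Rightarrow> (vertex \<Rightarrow> int) \<Rightarrow> 'p padic"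
where
  "gibbs_weight k J J1 h n \<sigma> =
    padic_exp (hamiltonian k J J1 n \<sigma>) *
    (\<Prod>(x, y)\<in>(SIGMA x:tree_sphere k (n - 1). successors k x).
       h x y (\<sigma> x) (\<sigma> y) powi (\<sigma> x * \<sigma> y))"

definition partition_function ::
  "nat \<Rightarrow> 'p::prime_card padic \<Rightarrow> 'p padic \<Rightarrow> 'p boundary_field \<Rightarrow> nat \<Rightarrow> 'p padic" where
  "partition_function k J J1 h n = (\<Sum>\<sigma>\<in>configs (tree_ball k n). gibbs_weight k J J1 h n \<sigma>)"

definition gibbs_finite ::
  "nat \<Rightarrow> 'p::prime_card padic \<Rightarrow> 'p padic \<Rightarrow> 'p boundary_field \<Rightarrow> nat \<Rightarrow> (vertex \<Rightarrow> int) \<Rightarrow> 'p padic"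
where
  "gibbs_finite k J J1 h n \<sigma> = gibbs_weight k J J1 h n \<sigma> / partition_function k J J1 h n"

text \<open>Division by zero is total in HOL, so the definedness of the weights and of their
  normalizations is a separate condition; only the fields for opposite spins are inverted.\<close>

definition field_defined ::
  "nat \<Rightarrow> 'p::prime_card padic \<Rightarrow> 'p padic \<Rightarrow> 'p boundary_field \<Rightarrow> bool" where
  "field_defined k J J1 h \<longleftrightarrow>
    (\<forall>(x, y)\<in>tree_edges k. h x y 1 (-1) \<noteq> 0 \<and> h x y (-1) 1 \<noteq> 0) \<and>
    (\<forall>n\<ge>1. partition_function k J J1 h n \<noteq> 0)"

definition compatible ::
  "nat \<Rightarrow> 'p::prime_card padic \<Rightarrow> 'p padic \<Rightarrow> 'p boundary_field \<Rightarrow> bool" where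
  "compatible k J J1 h \<longleftrightarrow>
    (\<forall>n\<ge>2. \<forall>\<sigma>\<in>configs (tree_ball k (n - 1)).
       (\<Sum>\<omega>\<in>configs (tree_sphere k n).
          gibbs_finite k J J1 h n (merge (tree_ball k (n - 1)) (tree_sphere k n) (\<sigma>, \<omega>)))
       = gibbs_finite k J J1 h (n - 1) \<sigma>)"


section \<open>p-adic measures and phase transitions\<close>

definition padic_measure :: "'a set \<Rightarrow> 'a set set \<Rightarrow> ('a set \<Rightarrow> 'p::prime_card padic) \<Rightarrow> bool" where
  "padic_measure X B \<mu> \<longleftrightarrow>
    algebra X B \<and> (\<forall>A\<in>B. \<forall>C\<in>B. A \<inter> C = {} \<longrightarrow> \<mu> (A \<union> C) = \<mu> A + \<mu> C)"

definition padic_probability_measure ::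
  "'a set \<Rightarrow> 'a set set \<Rightarrow> ('a set \<Rightarrow> 'p::prime_card padic) \<Rightarrow> bool" where
  "padic_probability_measure X B \<mu> \<longleftrightarrow> padic_measure X B \<mu> \<and> \<mu> X = 1"

definition padic_bounded :: "'a set set \<Rightarrow> ('a set \<Rightarrow> 'p::prime_card padic) \<Rightarrow> bool" where
  "padic_bounded B \<mu> \<longleftrightarrow> bdd_above ((\<lambda>A. padic_norm (\<mu> A)) ` B)"

definition cylinder :: "nat \<Rightarrow> nat \<Rightarrow> (vertex \<Rightarrow> int) set \<Rightarrow> (vertex \<Rightarrow> int) set" where
  "cylinder k n B = {\<sigma> \<in> configs (tree_vertices k). restrict \<sigma> (tree_ball k n) \<in> B}"

definition cylinder_sets :: "nat \<Rightarrow> (vertex \<Rightarrow> int) set set" where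
  "cylinder_sets k = {cylinder k n B | n B. B \<subseteq> configs (tree_ball k n)}"

definition quasi_gibbs_measure ::
  "nat \<Rightarrow> 'p::prime_card padic \<Rightarrow> 'p padic \<Rightarrow> ((vertex \<Rightarrow> int) set \<Rightarrow> 'p padic) \<Rightarrow> bool" where
  "quasi_gibbs_measure k J J1 \<mu> \<longleftrightarrow>
    padic_probability_measure (configs (tree_vertices k)) (cylinder_sets k) \<mu> \<and>
    (\<exists>h. field_defined k J J1 h \<and> compatible k J J1 h \<and>
      (\<forall>n\<ge>1. \<forall>\<sigma>\<in>configs (tree_ball k n). \<mu> (cylinder k n {\<sigma>}) = gibbs_finite k J J1 h n \<sigma>))"

text \<open>A measure is a function on the cylinder algebra; values elsewhere carry no meaning, so
  distinctness is tested on cylinder sets.\<close>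

definition phase_transition :: "nat \<Rightarrow> 'p::prime_card padic \<Rightarrow> 'p padic \<Rightarrow> bool" where
  "phase_transition k J J1 \<longleftrightarrow>
    (\<exists>\<mu> \<nu>. quasi_gibbs_measure k J J1 \<mu> \<and> quasi_gibbs_measure k J J1 \<nu> \<and>
      (\<exists>A\<in>cylinder_sets k. \<mu> A \<noteq> \<nu> A) \<and>
      padic_bounded (cylinder_sets k) \<mu> \<and> \<not> padic_bounded (cylinder_sets k) \<nu>)"

end

theory Submission
  imports Defs
begin

text \<open>
  Take a field symmetric under the global spin flip: it is given by one number \<open>z y\<close> per edge
  into \<open>y\<close>, contributing \<open>z y\<close> if the two spins agree and \<open>1\<close> otherwise. With \<open>A = a\<^sup>2\<close> and
  \<open>B = b\<^sup>2\<close>, compatibility becomes \<open>z y = (\<Prod>i<k. \<phi> (z (i # y)))\<close> with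
  \<open>\<phi> z = (A B z + 1) / (A z + B)\<close>, and passing to the next level multiplies the partition function
  by the product of the \<open>(A z + B) / (a b)\<close>. All weights are units, so the probability of a
  configuration has norm \<open>1 / |Z n|\<close>.

  On \<open>1 + p\<int>\<^sub>p\<close> the map \<open>\<phi>\<^sup>k\<close> is a contraction with \<open>|A z + B| = 1\<close>, and its fixed point gives a
  bounded measure. For the unbounded one the field is not translation invariant. The inverse of
  \<open>\<phi>\<close> sends every unit \<open>w\<close> with \<open>w \<noteq> 1 mod p\<close> to a point near \<open>-1\<close>, where \<open>|A z + B| = |B\<^sup>2 - 1| < 1\<close>.
  So one descends from the root, writing each \<open>z y\<close>, which is \<open>-1 mod p\<close>, as a product of \<open>k\<close>
  such units (possible when \<open>k\<close> is odd or \<open>p \<ge> 5\<close>, which both conditions on \<open>k\<close> and \<open>p\<close> imply) and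
  giving their preimages to the children; then \<open>|Z n|\<close> tends to \<open>0\<close>. A constant \<open>z\<close>
  would not do: for \<open>a = 1\<close> the only fixed point near \<open>-1\<close> may be \<open>-1\<close> itself, where \<open>Z 1 = 0\<close>.
\<close>


section \<open>The p-adic norm\<close>

lemma padic_norm_0 [simp]: "padic_norm (0 :: 'p::prime_card padic) = 0"
  by simp

lemma padic_norm_1 [simp]: "padic_norm (1 :: 'p::prime_card padic) = 1"
  using padic_norm_mult[of "1 :: 'p padic" 1] by simp

lemma padic_norm_power: "padic_norm (x ^ n :: 'p::prime_card padic) = padic_norm x ^ n"
  by (induction n) (simp_all add: padic_norm_mult)

lemma padic_norm_inverse: "padic_norm (inverse x :: 'p::prime_card padic) = inverse (padic_norm x)"
proof (cases "x = 0")
  case False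
  then show ?thesis
    using padic_norm_mult[of x "inverse x"] by (simp add: inverse_unique)
qed simp

lemma padic_norm_divide: "padic_norm (x / y :: 'p::prime_card padic) = padic_norm x / padic_norm y"
  by (simp add: field_class.field_divide_inverse padic_norm_mult padic_norm_inverse)

lemma padic_norm_prod:
  "padic_norm (\<Prod>i\<in>A. f i :: 'p::prime_card padic) = (\<Prod>i\<in>A. padic_norm (f i))"
  by (induction A rule: infinite_finite_induct) (simp_all add: padic_norm_mult)

lemma padic_norm_diff_commute: "padic_norm (x - y :: 'p::prime_card padic) = padic_norm (y - x)"
  using padic_norm_minus[of "x - y"] by simp

lemma padic_norm_add_le:
  "padic_norm x \<le> c \<Longrightarrow> padic_norm y \<le> c \<Longrightarrow> padic_norm (x + y :: 'p::prime_card padic) \<le> c"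
  using padic_norm_ultrametric[of x y] by simp

lemma padic_norm_diff_le:
  "padic_norm x \<le> c \<Longrightarrow> padic_norm y \<le> c \<Longrightarrow> padic_norm (x - y :: 'p::prime_card padic) \<le> c"
  using padic_norm_add_le[of x c "- y"] by simp

lemma padic_norm_add_less:
  "padic_norm x < c \<Longrightarrow> padic_norm y < c \<Longrightarrow> padic_norm (x + y :: 'p::prime_card padic) < c"
  using padic_norm_ultrametric[of x y] by simp

lemma padic_norm_diff_less:
  "padic_norm x < c \<Longrightarrow> padic_norm y < c \<Longrightarrow> padic_norm (x - y :: 'p::prime_card padic) < c"
  using padic_norm_add_less[of x c "- y"] by simp

text \<open>The isosceles property: if \<open>x + y\<close> were smaller than \<open>x\<close>, then
  \<open>x = (x + y) - y\<close> would be a difference of two numbers both smaller than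
  \<open>x\<close>.\<close>

lemma padic_norm_add_eq:
  assumes "padic_norm y < padic_norm (x :: 'p::prime_card padic)"
  shows "padic_norm (x + y) = padic_norm x"
proof (rule antisym)
  show "padic_norm (x + y) \<le> padic_norm x"
    using padic_norm_ultrametric[of x y] assms by simp
  show "padic_norm x \<le> padic_norm (x + y)"
    using padic_norm_diff_less[of "x + y" "padic_norm x" y] assms by force
qed

text \<open>The form in which units are recognized below: a number at distance less than 1 from a
  unit is a unit.\<close>

lemma padic_norm_eqI:
  assumes "padic_norm (x - y :: 'p::prime_card padic) < padic_norm y"
  shows "padic_norm x = padic_norm y"
  using padic_norm_add_eq[OF assms] by simp

lemma padic_norm_sum_le:
  assumes "\<And>i. i \<in> A \<Longrightarrow> padic_norm (f i :: 'p::prime_card padic) \<le> c" "0 \<le> c"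
  shows "padic_norm (\<Sum>i\<in>A. f i) \<le> c"
  using assms by (induction A rule: infinite_finite_induct) (auto intro: padic_norm_add_le)

text \<open>The cofactor of \<open>x - y\<close> in \<open>x ^ n - y ^ n\<close> is a sum of
  products of integral elements, so its norm is at most 1.\<close>

lemma padic_norm_power_diff_le:
  fixes x y :: "'p::prime_card padic"
  assumes "padic_norm x \<le> 1" "padic_norm y \<le> 1"
  shows "padic_norm (x ^ n - y ^ n) \<le> padic_norm (x - y)"
proof -
  have "padic_norm (\<Sum>i<n. y ^ (n - Suc i) * x ^ i) \<le> 1"
    using assms by (intro padic_norm_sum_le)
      (auto simp: padic_norm_mult padic_norm_power intro!: mult_le_one power_le_one)
  then show ?thesis
    unfolding power_diff_sumr2 padic_norm_mult by (simp add: mult_left_le)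
qed

section \<open>Norms of natural numbers\<close>

lemma padic_norm_of_nat:
  assumes "n > 0"
  shows "padic_norm (of_nat n :: 'p::prime_card padic)
    = real CARD('p) powi (- int (multiplicity (int CARD('p)) (int n)))"
  using padic_norm_rat_divide[OF prime_card[where 'a='p], of "int n" 1] assms
    padic_norm_of_rat[of "of_nat n", where 'p='p] by simp

lemma padic_norm_of_nat_card: "padic_norm (of_nat CARD('p) :: 'p::prime_card padic) = 1 / real CARD('p)"
proof -
  have "CARD('p) > 1" using prime_card[where 'a='p] prime_gt_1_nat by blast
  then have "multiplicity (int CARD('p)) (int CARD('p)) = 1"
    by (intro multiplicity_self) auto
  with \<open>CARD('p) > 1\<close> show ?thesis
    by (subst padic_norm_of_nat) (auto simp: power_int_minus divide_inverse)
qed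

lemma padic_norm_of_nat_eq_1:
  assumes "\<not> CARD('p) dvd n"
  shows "padic_norm (of_nat n :: 'p::prime_card padic) = 1"
proof -
  have "n > 0" using assms by (cases n) auto
  moreover have "multiplicity (int CARD('p)) (int n) = 0"
    using assms by (intro not_dvd_imp_multiplicity_0) (simp add: int_dvd_int_iff)
  ultimately show ?thesis by (simp add: padic_norm_of_nat)
qed

lemma padic_norm_numeral_eq_1:
  assumes "\<not> CARD('p) dvd numeral n"
  shows "padic_norm (numeral n :: 'p::prime_card padic) = 1"
  using padic_norm_of_nat_eq_1[OF assms] by simp


section \<open>The p-adic exponential\<close>

text \<open>Only the multiples of p among \<open>1, ..., n\<close> contribute to the norm. There are
  \<open>m = n div p\<close> of them, and their product is p^m times \<open>fact m\<close>.\<close>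

lemma padic_norm_fact_div:
  "padic_norm (fact n :: 'p::prime_card padic)
    = (1 / real CARD('p)) ^ (n div CARD('p)) * padic_norm (fact (n div CARD('p)) :: 'p padic)"
proof (induction n)
  case (Suc n)
  define p where "p = CARD('p)"
  have p: "p > 0"
    unfolding p_def using prime_card[where 'a='p] by (rule prime_gt_0_nat)
  have eq: "(fact (Suc n) :: 'p padic) = of_nat (Suc n) * fact n" by (rule fact_Suc)
  show ?case
  proof (cases "p dvd Suc n")
    case True
    define m where "m = n div p"
    have div: "Suc n div p = Suc m"
      using True by (simp add: div_Suc m_def dvd_eq_mod_eq_0)
    have "of_nat (Suc n) = (of_nat p * of_nat (Suc m) :: 'p padic)"
      using dvd_mult_div_cancel[OF True] div by (metis of_nat_mult)
    then have "padic_norm (of_nat (Suc n) :: 'p padic) = 1 / real p * padic_norm (of_nat (Suc m) :: 'p padic)"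
      by (simp only: padic_norm_mult p_def padic_norm_of_nat_card)
    moreover have "(fact (Suc m) :: 'p padic) = of_nat (Suc m) * fact m" by (rule fact_Suc)
    ultimately show ?thesis
      using Suc unfolding eq padic_norm_mult by (simp only: p_def[symmetric] div m_def[symmetric] padic_norm_mult) simp
  next
    case False
    then have "Suc n div p = n div p" by (simp add: div_Suc dvd_eq_mod_eq_0)
    moreover have "padic_norm (of_nat (Suc n) :: 'p padic) = 1"
      using False unfolding p_def by (rule padic_norm_of_nat_eq_1)
    ultimately show ?thesis
      using Suc unfolding eq padic_norm_mult p_def[symmetric] by simp
  qed
qed simp

text \<open>A weak form of Legendre's formula, \<open>v(n!) \<le> (n - 1) / (p - 1) \<le> (n - 1) / 2\<close>.\<close>

lemma padic_norm_fact_ge: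
  assumes "CARD('p::prime_card) \<ge> 3"
  shows "(1 / real CARD('p)) ^ n \<le> padic_norm (fact (Suc n) :: 'p padic) ^ 2"
proof (induction n rule: less_induct)
  case (less n)
  define p where "p = CARD('p)"
  have p: "p \<ge> 3" using assms p_def by simp
  define m where "m = Suc n div p"
  have eq: "padic_norm (fact (Suc n) :: 'p padic) = (1 / real p) ^ m * padic_norm (fact m :: 'p padic)"
    unfolding m_def p_def by (rule padic_norm_fact_div)
  show ?case
  proof (cases m)
    case 0
    then show ?thesis using eq p by (simp add: p_def[symmetric] power_le_one)
  next
    case (Suc l)
    \<comment> \<open>Here \<open>p \<ge> 3\<close> enters. Since \<open>m = Suc l\<close>, the
      exponent \<open>2 * m + l\<close> equals \<open>3 * m - 1 \<le> n\<close>; it collects the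
      squared factor (1/p)^m and the induction hypothesis at \<open>l\<close>.\<close>
    have "m * 3 \<le> m * p" using p by simp
    also have "\<dots> \<le> Suc n" by (simp add: m_def)
    finally have n: "2 * m + l \<le> n" using Suc by simp
    then have "l < n" using Suc by simp
    have "(1 / real p) ^ n \<le> (1 / real p) ^ (2 * m + l)"
      using n p by (intro power_decreasing) auto
    also have "\<dots> \<le> ((1 / real p) ^ m)\<^sup>2 * padic_norm (fact m :: 'p padic) ^ 2"
      using less[OF \<open>l < n\<close>] Suc
      unfolding Suc p_def[symmetric] power_add power_even_eq by (intro mult_left_mono) auto
    finally show ?thesis by (simp only: eq p_def[symmetric] power_mult_distrib)
  qed
qed

text \<open>\<open>\<rho>\<close> is p^(-1/2). The bound on factorials costs at most half of the
  powers of p that \<open>x ^ n\<close> gains when the norm of \<open>x\<close> is at most 1/p, so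
  the terms of the exponential series still decay like the powers of \<open>\<rho>\<close>.\<close>

context
  fixes \<rho> :: real
  assumes card_ge_3: "CARD('p::prime_card) \<ge> 3"
  defines "\<rho> \<equiv> sqrt (1 / real CARD('p))"
begin

lemma card_pos: "real CARD('p) > 0"
  using card_ge_3 by linarith

lemma rho_bounds: "0 < \<rho>" "\<rho> < 1" "\<rho>\<^sup>2 = 1 / real CARD('p)" "1 / real CARD('p) \<le> \<rho>"
proof -
  show "0 < \<rho>" "\<rho> < 1" "\<rho>\<^sup>2 = 1 / real CARD('p)"
    using card_ge_3 by (auto simp: \<rho>_def)
  then have "\<rho> * \<rho> \<le> \<rho> * 1" by (intro mult_left_mono) auto
  then show "1 / real CARD('p) \<le> \<rho>" 
    using \<open>\<rho>\<^sup>2 = 1 / real CARD('p)\<close> by (simp add: power2_eq_square)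
qed

text \<open>One factor \<open>padic_norm x\<close> is kept apart, so that the terms of degree at
  least 2 can later be compared with the linear term \<open>x\<close>. The estimate is proved for
  squares because the factorial bound is one for squares.\<close>

lemma padic_exp_term_Suc_le:
  assumes x: "padic_norm (x :: 'p padic) \<le> 1 / real CARD('p)"
  shows "padic_norm (x ^ Suc n / fact (Suc n)) \<le> padic_norm x * \<rho> ^ n"
proof -
  define r where "r = 1 / real CARD('p)"
  define f where "f = padic_norm (fact (Suc n) :: 'p padic)"
  have r: "r > 0" using card_pos by (simp add: r_def)
  have f: "r ^ n \<le> f\<^sup>2" "f > 0"
    using padic_norm_fact_ge[OF card_ge_3, of n] by (auto simp: r_def f_def less_le simp del: fact_Suc)
  have "(padic_norm x ^ n)\<^sup>2 \<le> (r ^ n)\<^sup>2"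
    using x by (intro power_mono) (auto simp: r_def)
  also have "\<dots> \<le> r ^ n * f\<^sup>2"
    using f r by (simp add: power2_eq_square mult_left_mono)
  also have "\<dots> = (\<rho> ^ n * f)\<^sup>2"
    unfolding r_def rho_bounds(3)[symmetric]
    by (simp add: power_mult_distrib power_mult[symmetric] mult.commute)
  finally have "padic_norm x ^ n \<le> \<rho> ^ n * f"
    by (rule power2_le_imp_le) (use f rho_bounds in auto)
  then have "padic_norm x * padic_norm x ^ n \<le> padic_norm x * (\<rho> ^ n * f)"
    by (intro mult_left_mono) auto
  then show ?thesis
    using f(2) unfolding padic_norm_divide padic_norm_power f_def[symmetric]
    by (simp add: pos_divide_le_eq mult.assoc)
qed

lemma padic_exp_term_le:
  assumes x: "padic_norm (x :: 'p padic) \<le> 1 / real CARD('p)"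
  shows "padic_norm (x ^ n / fact n) \<le> \<rho> ^ n"
proof (cases n)
  case (Suc m)
  have "padic_norm (x ^ n / fact n) \<le> padic_norm x * \<rho> ^ m"
    unfolding Suc by (rule padic_exp_term_Suc_le[OF x])
  also have "\<dots> \<le> \<rho> * \<rho> ^ m"
    using x rho_bounds by (intro mult_right_mono) auto
  finally show ?thesis by (simp add: Suc)
qed simp

lemma padic_exp_tail_le:
  assumes x: "padic_norm (x :: 'p padic) \<le> 1 / real CARD('p)" and "N \<le> M"
  shows "padic_norm ((\<Sum>n<M. x ^ n / fact n) - (\<Sum>n<N. x ^ n / fact n)) \<le> \<rho> ^ N"
proof -
  have "(\<Sum>n<M. x ^ n / fact n) - (\<Sum>n<N. x ^ n / fact n) = (\<Sum>n=N..<M. x ^ n / fact n)"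
    using \<open>N \<le> M\<close> by (simp add: sum_diff_nat_ivl atLeast0LessThan[symmetric])
  moreover have "padic_norm (x ^ n / fact n) \<le> \<rho> ^ N" if "n \<ge> N" for n
  proof -
    have "\<rho> ^ n \<le> \<rho> ^ N" using that rho_bounds by (intro power_decreasing) auto
    then show ?thesis using padic_exp_term_le[OF x, of n] by linarith
  qed
  ultimately show ?thesis
    using rho_bounds by (auto intro!: padic_norm_sum_le)
qed

text \<open>By the tail bound the partial sums are Cauchy, and completeness gives the limit. The
  explicit error lets identities for the exponential be checked on partial sums, up to
  \<open>\<rho> ^ N\<close> for every \<open>N\<close>.\<close>

lemma padic_exp_approx:
  assumes x: "padic_norm (x :: 'p padic) \<le> 1 / real CARD('p)"
  shows "padic_norm (padic_exp x - (\<Sum>n<N. x ^ n / fact n)) \<le> \<rho> ^ N"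
proof -
  define E where "E N = (\<Sum>n<N. x ^ n / fact n)" for N
  have small: "\<exists>N. \<rho> ^ N < e" if "e > 0" for e
    using real_arch_pow_inv[OF that] rho_bounds by auto
  have tail: "padic_norm (E m - E n) \<le> \<rho> ^ N" if "m \<ge> N" "n \<ge> N" for m n N
  proof -
    have "padic_norm (E m - E N - (E n - E N)) \<le> \<rho> ^ N"
      using that unfolding E_def by (intro padic_norm_diff_le[OF padic_exp_tail_le[OF x] padic_exp_tail_le[OF x]])
    then show ?thesis by simp
  qed
  have "Cauchy E"
  proof (rule metric_CauchyI)
    fix e :: real assume "e > 0"
    then obtain N where "\<rho> ^ N < e" using small by blast
    then show "\<exists>M. \<forall>m\<ge>M. \<forall>n\<ge>M. dist (E m) (E n) < e"
      using tail unfolding dist_padic_def by (meson le_less_trans)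
  qed
  then obtain L where L: "E \<longlonglongrightarrow> L"
    using Cauchy_convergent_iff convergent_def by blast
  then have "(\<lambda>n. x ^ n / fact n) sums L" by (simp add: sums_def E_def[abs_def])
  then have exp: "padic_exp x = L" by (simp add: padic_exp_def sums_unique[symmetric])
  have "\<rho> ^ N > 0" using rho_bounds by simp
  then obtain K where K: "\<And>m. m \<ge> K \<Longrightarrow> padic_norm (E m - L) < \<rho> ^ N"
    using L unfolding lim_sequentially dist_padic_def by blast
  define M where "M = max K N"
  have "padic_norm ((E M - E N) - (E M - L)) \<le> \<rho> ^ N"
    using K[of M] tail[of N M N] by (intro padic_norm_diff_le[of "E M - E N"]) (auto simp: M_def)
  then show ?thesis by (simp add: exp E_def)
qed

section \<open>Size and functional equation of the exponential\<close>

lemma padic_eqI_small: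
  assumes "\<And>N. padic_norm (x - y :: 'p padic) \<le> \<rho> ^ N"
  shows "x = y"
proof (rule ccontr)
  assume "x \<noteq> y"
  then have "padic_norm (x - y) > 0" by (simp add: less_le)
  then obtain N where "\<rho> ^ N < padic_norm (x - y)"
    using real_arch_pow_inv[of "padic_norm (x - y)" \<rho>] rho_bounds by auto
  then show False using assms[of N] by simp
qed

lemma padic_exp_partial_le_1:
  assumes x: "padic_norm (x :: 'p padic) \<le> 1 / real CARD('p)"
  shows "padic_norm (\<Sum>n<N. x ^ n / fact n) \<le> 1"
proof (rule padic_norm_sum_le)
  fix n
  have "\<rho> ^ n \<le> 1" using rho_bounds by (intro power_le_one) auto
  then show "padic_norm (x ^ n / fact n) \<le> 1"
    using padic_exp_term_le[OF x, of n] by (rule order_trans[rotated])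
qed simp

text \<open>The linear term dominates: all terms of degree at least 2 have norm at most
  \<open>padic_norm x * \<rho>\<close>, which is smaller than \<open>padic_norm x\<close> unless
  \<open>x = 0\<close>.\<close>

lemma padic_exp_sub_1:
  assumes x: "padic_norm (x :: 'p padic) \<le> 1 / real CARD('p)"
  shows "padic_norm (padic_exp x - 1) = padic_norm x"
proof (cases "x = 0")
  case True
  have "padic_norm (padic_exp x - 1) \<le> \<rho> ^ N" for N
  proof -
    have "\<rho> ^ Suc N \<le> \<rho> ^ N" using rho_bounds by (intro power_decreasing) auto
    moreover have "(\<Sum>n<Suc N. x ^ n / fact n) = 1"
      unfolding sum.lessThan_Suc_shift by (simp add: True)
    ultimately show ?thesis
      using padic_exp_approx[OF x, of "Suc N"] by simp
  qed
  then have "padic_exp x = 1" by (rule padic_eqI_small)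
  then show ?thesis using True by simp
next
  case False
  define E where "E N = (\<Sum>n<N. x ^ n / fact n)" for N
  have pos: "padic_norm x * \<rho> > 0" using False rho_bounds by (simp add: less_le)
  then obtain K where K: "\<rho> ^ K < padic_norm x * \<rho>"
    using real_arch_pow_inv rho_bounds by blast
  \<comment> \<open>Two extra terms, so that degrees 0 and 1 split off and \<open>K\<close> terms
    remain; the truncation error \<open>\<rho> ^ N\<close> is still below
    \<open>padic_norm x * \<rho>\<close>.\<close>
  define N where "N = Suc (Suc K)"
  have "\<rho> ^ N \<le> \<rho> ^ K"
    unfolding N_def using rho_bounds by (intro power_decreasing) auto
  then have 1: "padic_norm (padic_exp x - E N) \<le> padic_norm x * \<rho>"
    using padic_exp_approx[OF x, of N] K unfolding E_def by simp
  have "E N - 1 - x = (\<Sum>n<K. x ^ Suc (Suc n) / fact (Suc (Suc n)))"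
    unfolding E_def N_def sum.lessThan_Suc_shift by (simp del: fact_Suc power_Suc)
  also have "padic_norm \<dots> \<le> padic_norm x * \<rho>"
  proof (rule padic_norm_sum_le)
    fix n
    have "\<rho> ^ Suc n \<le> \<rho> ^ 1" using rho_bounds by (intro power_decreasing) auto
    then have "padic_norm x * \<rho> ^ Suc n \<le> padic_norm x * \<rho>"
      by (intro mult_left_mono) auto
    then show "padic_norm (x ^ Suc (Suc n) / fact (Suc (Suc n))) \<le> padic_norm x * \<rho>"
      using padic_exp_term_Suc_le[OF x, of "Suc n"] by (rule order_trans[rotated])
  qed (use pos in simp)
  finally have "padic_norm ((padic_exp x - E N) + (E N - 1 - x)) \<le> padic_norm x * \<rho>"
    using 1 by (intro padic_norm_add_le)
  also have "\<dots> < padic_norm x" using False rho_bounds by (simp add: less_le)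
  finally show ?thesis by (intro padic_norm_eqI) (simp add: algebra_simps)
qed

lemma padic_exp_norm:
  assumes "padic_norm (x :: 'p padic) \<le> 1 / real CARD('p)"
  shows "padic_norm (padic_exp x) = 1"
proof -
  have "1 / real CARD('p) < 1" using card_ge_3 by simp
  then have "padic_norm (padic_exp x - 1) < padic_norm (1 :: 'p padic)"
    using assms padic_exp_sub_1[OF assms] by simp
  then show ?thesis using padic_norm_eqI by fastforce
qed

text \<open>By the binomial theorem the N-th partial sum at \<open>x + y\<close> consists of the
  terms \<open>t i j\<close> with \<open>i + j < N\<close>. The product of the two partial sums
  contains in addition only terms with \<open>i + j \<ge> N\<close>, each of norm at most
  \<open>\<rho> ^ N\<close>.\<close>

lemma padic_exp_add:
  fixes x y :: "'p padic"
  assumes x: "padic_norm x \<le> 1 / real CARD('p)" and y: "padic_norm y \<le> 1 / real CARD('p)"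
  shows "padic_exp (x + y) = padic_exp x * padic_exp y"
proof (rule padic_eqI_small)
  fix N
  define E where "E z = (\<Sum>n<N. z ^ n / fact n)" for z :: "'p padic"
  define t where "t i j = (x ^ i / fact i) * (y ^ j / fact j)" for i j
  have xy: "padic_norm (x + y) \<le> 1 / real CARD('p)" by (rule padic_norm_add_le[OF x y])
  have "E (x + y) = (\<Sum>n<N. \<Sum>i\<le>n. t i (n - i))"
    unfolding E_def
  proof (rule sum.cong)
    fix n
    have "of_nat (n choose i) * x ^ i * y ^ (n - i) / fact n = t i (n - i)" if "i \<le> n" for i
      using that by (simp add: t_def binomial_fact field_simps)
    then show "(x + y) ^ n / fact n = (\<Sum>i\<le>n. t i (n - i))"
      unfolding binomial_ring sum_divide_distrib by (intro sum.cong) auto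
  qed simp
  also have "\<dots> = (\<Sum>(i, j)\<in>{(i, j). i + j < N}. t i j)"
    by (rule sum.triangle_reindex[symmetric])
  finally have E_add: "E (x + y) = (\<Sum>(i, j)\<in>{(i, j). i + j < N}. t i j)" .
  have E_mult: "E x * E y = (\<Sum>(i, j)\<in>{..<N} \<times> {..<N}. t i j)"
    unfolding E_def t_def by (simp add: sum_product sum.cartesian_product)
  have "E x * E y - E (x + y) = (\<Sum>(i, j)\<in>{..<N} \<times> {..<N} - {(i, j). i + j < N}. t i j)"
    unfolding E_add E_mult by (rule sum_diff[symmetric]) auto
  also have "padic_norm \<dots> \<le> \<rho> ^ N"
  proof (rule padic_norm_sum_le)
    fix q assume q: "q \<in> {..<N} \<times> {..<N} - {(i, j). i + j < N}"
    obtain i j where ij: "q = (i, j)" by (cases q)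
    have "padic_norm (t i j) \<le> \<rho> ^ i * \<rho> ^ j"
      unfolding t_def padic_norm_mult
      using padic_exp_term_le[OF x] padic_exp_term_le[OF y] rho_bounds by (intro mult_mono) auto
    also have "\<dots> \<le> \<rho> ^ N"
      using q ij rho_bounds by (auto simp: power_add[symmetric] intro!: power_decreasing)
    finally show "padic_norm (case q of (i, j) \<Rightarrow> t i j) \<le> \<rho> ^ N" by (simp add: ij)
  qed (use rho_bounds in auto)
  finally have 1: "padic_norm (E (x + y) - E x * E y) \<le> \<rho> ^ N"
    by (simp add: padic_norm_diff_commute)
  have approx: "padic_norm (padic_exp z - E z) \<le> \<rho> ^ N" if "padic_norm z \<le> 1 / real CARD('p)" for z
    unfolding E_def by (rule padic_exp_approx[OF that])
  have exp_y: "padic_norm (padic_exp y) = 1"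
    by (rule padic_exp_norm[OF y])
  have 2: "padic_norm ((padic_exp x - E x) * padic_exp y) \<le> \<rho> ^ N"
    using approx[OF x] exp_y by (simp add: padic_norm_mult)
  have "padic_norm (E x * (padic_exp y - E y)) \<le> 1 * \<rho> ^ N"
    unfolding padic_norm_mult using approx[OF y] padic_exp_partial_le_1[OF x, of N]
    by (intro mult_mono) (auto simp: E_def)
  with 2 have "padic_norm ((padic_exp x - E x) * padic_exp y + E x * (padic_exp y - E y)) \<le> \<rho> ^ N"
    by (intro padic_norm_add_le) auto
  \<comment> \<open>The errors telescope to
    \<open>padic_exp (x + y) - padic_exp x * padic_exp y\<close>.\<close>
  then have "padic_norm ((padic_exp (x + y) - E (x + y)) + (E (x + y) - E x * E y)
      - ((padic_exp x - E x) * padic_exp y + E x * (padic_exp y - E y))) \<le> \<rho> ^ N"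
    by (rule padic_norm_diff_le[OF padic_norm_add_le[OF approx[OF xy] 1]])
  then show "padic_norm (padic_exp (x + y) - padic_exp x * padic_exp y) \<le> \<rho> ^ N"
    by (simp add: algebra_simps)
qed

lemma padic_exp_0: "padic_exp (0 :: 'p padic) = 1"
  using padic_exp_sub_1[of 0] by simp

lemma padic_exp_minus:
  assumes "padic_norm (x :: 'p padic) \<le> 1 / real CARD('p)"
  shows "padic_exp (- x) = inverse (padic_exp x)"
  using padic_exp_add[of x "- x"] assms padic_exp_0 by (simp add: inverse_unique[symmetric])

lemma padic_exp_sum:
  assumes "finite A" "\<And>i. i \<in> A \<Longrightarrow> padic_norm (f i :: 'p padic) \<le> 1 / real CARD('p)"
  shows "padic_exp (\<Sum>i\<in>A. f i) = (\<Prod>i\<in>A. padic_exp (f i))"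
  using assms
proof (induction A rule: finite_induct)
  case (insert i A)
  then have "padic_norm (\<Sum>i\<in>A. f i) \<le> 1 / real CARD('p)" by (intro padic_norm_sum_le) auto
  with insert show ?case by (simp add: padic_exp_add)
qed (simp add: padic_exp_0)

end


section \<open>The tree as a set of lists\<close>

lemma tree_vertices_Nil [simp]: "[] \<in> tree_vertices k"
  by (simp add: tree_vertices_def)

lemma tree_vertices_Cons [simp]: "i # x \<in> tree_vertices k \<longleftrightarrow> i < k \<and> x \<in> tree_vertices k"
  by (auto simp: tree_vertices_def)

lemma tree_vertices_append [simp]:
  "x @ y \<in> tree_vertices k \<longleftrightarrow> x \<in> tree_vertices k \<and> y \<in> tree_vertices k"
  by (auto simp: tree_vertices_def)

lemma tree_vertices_tl: "x \<in> tree_vertices k \<Longrightarrow> tl x \<in> tree_vertices k"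
  by (cases x) auto

abbreviation (input) tree_adj :: "nat \<Rightarrow> (vertex \<times> vertex) set" where
  "tree_adj k \<equiv> tree_edges k \<union> (tree_edges k)\<inverse>"

lemma tree_walk_length:
  "(x, y) \<in> tree_adj k ^^ n \<Longrightarrow> length y \<le> length x + n \<and> length x \<le> length y + n"
proof (induction n arbitrary: y)
  case (Suc n)
  then obtain z where "(x, z) \<in> tree_adj k ^^ n" "(z, y) \<in> tree_adj k" by (auto elim: relpow_Suc_E)
  then show ?case using Suc.IH[of z] by (fastforce simp: tree_edges_def)
qed simp

lemma tree_walk_up: "y @ x \<in> tree_vertices k \<Longrightarrow> (y @ x, x) \<in> tree_adj k ^^ length y"
proof (induction y)
  case (Cons i y)
  then have "(i # y @ x, y @ x) \<in> tree_adj k" by (auto simp: tree_edges_def)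
  then show ?case using Cons by (metis append_Cons length_Cons relpow_Suc_I2 tree_vertices_Cons)
qed simp

lemma tree_walk_down: "y @ x \<in> tree_vertices k \<Longrightarrow> (x, y @ x) \<in> tree_adj k ^^ length y"
proof (induction y)
  case (Cons i y)
  then have "(y @ x, i # y @ x) \<in> tree_adj k" by (auto simp: tree_edges_def)
  then show ?case using Cons by (metis append_Cons length_Cons relpow_Suc_I tree_vertices_Cons)
qed simp

lemma tree_dist_walk:
  assumes "x \<in> tree_vertices k" "y \<in> tree_vertices k"
  shows "(x, y) \<in> tree_adj k ^^ tree_dist k x y"
proof -
  have "(x, []) \<in> tree_adj k ^^ length x" "([], y) \<in> tree_adj k ^^ length y"
    using tree_walk_up[of x "[]" k] tree_walk_down[of y "[]" k] assms by auto
  then have "(x, y) \<in> tree_adj k ^^ (length x + length y)" by (auto simp: relpow_add)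
  then show ?thesis unfolding tree_dist_def by (rule LeastI)
qed

lemma tree_dist_Nil [simp]:
  assumes "x \<in> tree_vertices k"
  shows "tree_dist k x [] = length x"
  unfolding tree_dist_def
proof (rule Least_equality)
  show "(x, []) \<in> tree_adj k ^^ length x" using tree_walk_up[of x "[]" k] assms by auto
qed (use tree_walk_length in fastforce)

text \<open>Each step changes the depth by one, so a walk that gains depth \<open>n\<close> in
  \<open>n\<close> steps only descends, and every step prepends one child index.\<close>

lemma tree_walk_monotone:
  "(x, y) \<in> tree_adj k ^^ n \<Longrightarrow> length y = length x + n \<Longrightarrow> drop n y = x"
proof (induction n arbitrary: y)
  case (Suc n)
  then obtain z where z: "(x, z) \<in> tree_adj k ^^ n" "(z, y) \<in> tree_adj k" by (auto elim: relpow_Suc_E)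
  then have "length z \<le> length x + n" using tree_walk_length by blast
  then obtain i where "y = i # z" using z(2) Suc.prems by (auto simp: tree_edges_def)
  then show ?case using Suc.IH[OF z(1)] Suc.prems by simp
qed simp

text \<open>As the head of a list is the latest child index, \<open>drop n y\<close> is the ancestor
  of \<open>y\<close> by \<open>n\<close> levels. The case \<open>n = 1\<close> identifies
  successors, and \<open>n = 2\<close> the prolonged next-nearest neighbors.\<close>

lemma tree_dist_descendant:
  assumes "x \<in> tree_vertices k" "y \<in> tree_vertices k" "length y = length x + n"
  shows "tree_dist k x y = n \<longleftrightarrow> drop n y = x"
proof
  assume "tree_dist k x y = n"
  then show "drop n y = x" using tree_dist_walk[OF assms(1,2)] tree_walk_monotone assms(3) by blast
next
  assume "drop n y = x"
  then have y: "y = take n y @ x" by (metis append_take_drop_id)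
  have "(x, take n y @ x) \<in> tree_adj k ^^ length (take n y)"
    using assms(2) y by (intro tree_walk_down) metis
  then have "(x, y) \<in> tree_adj k ^^ n" using y assms(3) by simp
  then show "tree_dist k x y = n"
    unfolding tree_dist_def using tree_walk_length[of x y _ k] assms(3)
    by (intro Least_equality) fastforce+
qed

section \<open>Spheres, balls and neighbor pairs described by lists\<close>

lemma tree_sphere_eq: "tree_sphere k n = {x \<in> tree_vertices k. length x = n}"
  by (auto simp: tree_sphere_def)

lemma tree_ball_eq: "tree_ball k n = {x \<in> tree_vertices k. length x \<le> n}"
  by (auto simp: tree_ball_def tree_sphere_eq)

lemma finite_tree_sphere [simp]: "finite (tree_sphere k n)"
  using finite_lists_length_eq[of "{..<k}" n] by (simp add: tree_sphere_eq tree_vertices_def)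

lemma finite_tree_ball [simp]: "finite (tree_ball k n)"
  by (simp add: tree_ball_def)

lemma tree_ball_Suc: "tree_ball k (Suc n) = tree_ball k n \<union> tree_sphere k (Suc n)"
  by (auto simp: tree_ball_eq tree_sphere_eq)

lemma tree_ball_sphere_disjoint: "tree_ball k n \<inter> tree_sphere k (Suc n) = {}"
  by (auto simp: tree_ball_eq tree_sphere_eq)

lemma tree_ball_mono: "m \<le> n \<Longrightarrow> tree_ball k m \<subseteq> tree_ball k n"
  by (auto simp: tree_ball_eq)

lemma tree_ball_subset: "tree_ball k n \<subseteq> tree_vertices k"
  by (auto simp: tree_ball_eq)

lemma successors_eq: "x \<in> tree_vertices k \<Longrightarrow> successors k x = (\<lambda>i. i # x) ` {..<k}"
proof (intro set_eqI iffI)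
  fix y assume x: "x \<in> tree_vertices k" and "y \<in> successors k x"
  then have y: "y \<in> tree_vertices k" "length y = length x + 1" "tree_dist k x y = 1"
    by (auto simp: successors_def tree_sphere_eq)
  then have "drop 1 y = x" using tree_dist_descendant[OF x y(1,2)] by simp
  then show "y \<in> (\<lambda>i. i # x) ` {..<k}" using y by (cases y) auto
next
  fix y assume "x \<in> tree_vertices k" and "y \<in> (\<lambda>i. i # x) ` {..<k}"
  then show "y \<in> successors k x"
    using tree_dist_descendant[of x k y 1] by (auto simp: successors_def tree_sphere_eq)
qed

lemma tree_sphere_Suc: "tree_sphere k (Suc n) = (\<lambda>(x, i). i # x) ` (tree_sphere k n \<times> {..<k})"
proof (intro set_eqI iffI)
  fix y assume "y \<in> tree_sphere k (Suc n)"
  then show "y \<in> (\<lambda>(x, i). i # x) ` (tree_sphere k n \<times> {..<k})"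
    by (cases y) (auto simp: tree_sphere_eq)
qed (auto simp: tree_sphere_eq)

lemma prod_tree_sphere_Suc:
  "(\<Prod>y\<in>tree_sphere k (Suc n). f y) = (\<Prod>x\<in>tree_sphere k n. \<Prod>i<k. f (i # x))"
proof -
  have "(\<Prod>y\<in>tree_sphere k (Suc n). f y) = (\<Prod>q\<in>tree_sphere k n \<times> {..<k}. f (snd q # fst q))"
    unfolding tree_sphere_Suc
    by (subst prod.reindex) (auto simp: inj_on_def case_prod_unfold)
  then show ?thesis by (simp add: prod.cartesian_product case_prod_unfold)
qed

text \<open>An edge is indexed by its endpoint farther from the root, whose parent is its tail. Sums
  over edges thus become sums over vertices; the next lemma does the same for prolonged pairs
  through the grandparent.\<close>

lemma ball_edges_eq: "ball_edges k n = (\<lambda>y. (tl y, y)) ` {y \<in> tree_ball k n. y \<noteq> []}"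
proof (intro set_eqI iffI)
  fix e assume "e \<in> ball_edges k n"
  then obtain i x where "e = (x, i # x)" "i # x \<in> tree_ball k n"
    by (auto simp: ball_edges_def tree_edges_def)
  then show "e \<in> (\<lambda>y. (tl y, y)) ` {y \<in> tree_ball k n. y \<noteq> []}" by force
next
  fix e assume "e \<in> (\<lambda>y. (tl y, y)) ` {y \<in> tree_ball k n. y \<noteq> []}"
  then obtain i x where "e = (x, i # x)" "i # x \<in> tree_ball k n" by (auto simp: neq_Nil_conv)
  then show "e \<in> ball_edges k n"
    by (auto simp: ball_edges_def tree_edges_def tree_ball_eq)
qed

lemma prolonged_neighbors_ball_eq:
  "{(x, y) \<in> prolonged_neighbors k. x \<in> tree_ball k n \<and> y \<in> tree_ball k n}
    = (\<lambda>y. (tl (tl y), y)) ` {y \<in> tree_ball k n. length y \<ge> 2}"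
proof (intro set_eqI iffI; clarify?)
  fix x y
  assume xy: "(x, y) \<in> prolonged_neighbors k" "x \<in> tree_ball k n" "y \<in> tree_ball k n"
  then have l: "x \<in> tree_vertices k" "y \<in> tree_vertices k" "length y = length x + 2" "tree_dist k x y = 2"
    by (auto simp: prolonged_neighbors_def tree_sphere_eq)
  then have "drop 2 y = x" using tree_dist_descendant by blast
  then have "x = tl (tl y)" by (simp add: drop_Suc numeral_2_eq_2)
  then show "(x, y) \<in> (\<lambda>y. (tl (tl y), y)) ` {y \<in> tree_ball k n. length y \<ge> 2}"
    using xy l by auto
next
  fix x y :: vertex
  assume y: "y \<in> tree_ball k n" "2 \<le> length y"
  then obtain i j z where z: "y = i # j # z" by (cases y rule: list.exhaust[case_product list.exhaust[of "tl y"]]) auto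
  then have "tree_dist k z y = 2"
    using y tree_dist_descendant[of z k y 2] by (auto simp: tree_ball_eq)
  then have "(z, y) \<in> prolonged_neighbors k"
    using y z by (auto simp: prolonged_neighbors_def tree_sphere_eq tree_ball_eq intro!: exI[of _ "length y"])
  then show "(tl (tl y), y) \<in> prolonged_neighbors k \<and> tl (tl y) \<in> tree_ball k n \<and> y \<in> tree_ball k n"
    using y z by (auto simp: tree_ball_eq)
qed


section \<open>Symmetric boundary fields\<close>

lemma finite_configs [simp]: "finite A \<Longrightarrow> finite (configs A)"
  by (auto simp: configs_def intro: finite_PiE)

lemma configs_values: "\<sigma> \<in> configs A \<Longrightarrow> x \<in> A \<Longrightarrow> \<sigma> x = -1 \<or> \<sigma> x = 1"
  by (auto simp: configs_def PiE_iff)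

lemma configs_merge:
  assumes "A \<inter> B = {}" "\<sigma> \<in> configs A" "\<omega> \<in> configs B"
  shows "merge A B (\<sigma>, \<omega>) \<in> configs (A \<union> B)"
  using assms by (auto simp: configs_def)

lemma sum_configs_Un:
  assumes "A \<inter> B = {}"
  shows "(\<Sum>\<tau>\<in>configs (A \<union> B). f \<tau>) = (\<Sum>\<sigma>\<in>configs A. \<Sum>\<omega>\<in>configs B. f (merge A B (\<sigma>, \<omega>)))"
proof -
  have "(\<Sum>\<tau>\<in>configs (A \<union> B). f \<tau>) = (\<Sum>q\<in>configs A \<times> configs B. f (merge A B q))"
  proof (rule sum.reindex_bij_witness[where i = "merge A B" and j = "\<lambda>\<tau>. (restrict \<tau> A, restrict \<tau> B)"])
    fix \<tau> assume "\<tau> \<in> configs (A \<union> B)"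
    then show "merge A B (restrict \<tau> A, restrict \<tau> B) = \<tau>"
      "(restrict \<tau> A, restrict \<tau> B) \<in> configs A \<times> configs B"
      by (auto simp: configs_def PiE_iff extensional_restrict)
    then show "f (merge A B (restrict \<tau> A, restrict \<tau> B)) = f \<tau>" by simp
  next
    fix q assume "q \<in> configs A \<times> configs B"
    then show "(restrict (merge A B q) A, restrict (merge A B q) B) = q" "merge A B q \<in> configs (A \<union> B)"
      using assms by (auto simp: configs_def)
  qed
  then show ?thesis by (simp add: sum.cartesian_product case_prod_unfold)
qed

definition sym_field :: "(vertex \<Rightarrow> 'p padic) \<Rightarrow> 'p::prime_card boundary_field" where
  "sym_field z x y s t = (if s = t then z y else 1)"

section \<open>Factorization of the Gibbs weights over the vertices\<close>

locale symmetric_model =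
  fixes k :: nat and J J1 a b :: "'p::prime_card padic" and z :: "vertex \<Rightarrow> 'p padic"
  assumes card_ge_3: "CARD('p) \<ge> 3"
    and norm_J: "padic_norm J \<le> 1 / real CARD('p)"
    and norm_J1: "padic_norm J1 \<le> 1 / real CARD('p)"
    and a_def: "a = padic_exp J" and b_def: "b = padic_exp J1"
begin

lemma norm_ab: "padic_norm a = 1" "padic_norm b = 1"
  using padic_exp_norm[OF card_ge_3] norm_J norm_J1 by (auto simp: a_def b_def)

lemma ab_nonzero [simp]: "a \<noteq> 0" "b \<noteq> 0"
  using norm_ab by auto

lemma exp_mult_sign:
  assumes "s = -1 \<or> s = (1 :: int)" "t = -1 \<or> t = (1 :: int)"
  shows "padic_exp (J * of_int (s * t)) = a powi (s * t)"
    and "padic_exp (J1 * of_int (s * t)) = b powi (s * t)"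
  using assms padic_exp_minus[OF card_ge_3] norm_J norm_J1
  by (auto simp: a_def b_def power_int_minus)

text \<open>The part of the Boltzmann factor charged to \<open>y\<close>: its bond with the parent
  and its bond with the grandparent. The case distinctions remove the missing bonds at levels 0 and
  1, where \<open>tl [] = []\<close> would produce spurious ones.\<close>

definition vertex_weight :: "(vertex \<Rightarrow> int) \<Rightarrow> vertex \<Rightarrow> 'p padic" where
  "vertex_weight \<sigma> y = (if y = [] then 1 else a powi (\<sigma> (tl y) * \<sigma> y)) *
    (if length y \<ge> 2 then b powi (\<sigma> (tl (tl y)) * \<sigma> y) else 1)"

definition leaf_weight :: "(vertex \<Rightarrow> int) \<Rightarrow> vertex \<Rightarrow> 'p padic" where
  "leaf_weight \<sigma> y = (if \<sigma> (tl y) = \<sigma> y then z y else 1)"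

text \<open>All summands of the Hamiltonian have norm at most 1/p, so the exponential turns the sum
  into a product; factors 1 then extend both products to the whole ball.\<close>

lemma exp_hamiltonian:
  assumes "\<sigma> \<in> configs (tree_ball k n)"
  shows "padic_exp (hamiltonian k J J1 n \<sigma>) = (\<Prod>y\<in>tree_ball k n. vertex_weight \<sigma> y)"
proof -
  define V where "V = tree_ball k n"
  define A where "A = {y \<in> V. y \<noteq> []}"
  define B where "B = {y \<in> V. length y \<ge> 2}"
  have fin: "finite V" "finite A" "finite B" by (auto simp: V_def A_def B_def)
  have sign: "\<sigma> x = -1 \<or> \<sigma> x = 1" if "x \<in> V" for x
    using configs_values[OF assms] that by (simp add: V_def)
  have V_tl: "tl x \<in> V" if "x \<in> V" for x
    using that by (auto simp: V_def tree_ball_eq tree_vertices_tl)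
  have J_le: "padic_norm (J * of_int (\<sigma> x * \<sigma> y)) \<le> 1 / real CARD('p)" "padic_norm (J1 * of_int (\<sigma> x * \<sigma> y)) \<le> 1 / real CARD('p)"
    if "x \<in> V" "y \<in> V" for x y
    using sign[OF that(1)] sign[OF that(2)] norm_J norm_J1 by auto
  have "hamiltonian k J J1 n \<sigma> = (\<Sum>y\<in>A. J * of_int (\<sigma> (tl y) * \<sigma> y))
      + (\<Sum>y\<in>B. J1 * of_int (\<sigma> (tl (tl y)) * \<sigma> y))"
    unfolding hamiltonian_def ball_edges_eq prolonged_neighbors_ball_eq A_def B_def V_def
    by (simp add: sum.reindex inj_on_def sum_distrib_left)
  also have "padic_exp \<dots> = padic_exp (\<Sum>y\<in>A. J * of_int (\<sigma> (tl y) * \<sigma> y))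
      * padic_exp (\<Sum>y\<in>B. J1 * of_int (\<sigma> (tl (tl y)) * \<sigma> y))"
    using J_le V_tl by (intro padic_exp_add[OF card_ge_3] padic_norm_sum_le) (auto simp: A_def B_def)
  also have "padic_exp (\<Sum>y\<in>A. J * of_int (\<sigma> (tl y) * \<sigma> y)) = (\<Prod>y\<in>A. padic_exp (J * of_int (\<sigma> (tl y) * \<sigma> y)))"
    using J_le V_tl fin by (intro padic_exp_sum[OF card_ge_3]) (auto simp: A_def)
  also have "\<dots> = (\<Prod>y\<in>A. a powi (\<sigma> (tl y) * \<sigma> y))"
    using exp_mult_sign(1) sign V_tl by (intro prod.cong) (auto simp: A_def)
  also have "\<dots> = (\<Prod>y\<in>V. if y = [] then 1 else a powi (\<sigma> (tl y) * \<sigma> y))"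
    using fin by (intro prod.mono_neutral_cong_left) (auto simp: A_def)
  also have "padic_exp (\<Sum>y\<in>B. J1 * of_int (\<sigma> (tl (tl y)) * \<sigma> y)) = (\<Prod>y\<in>B. padic_exp (J1 * of_int (\<sigma> (tl (tl y)) * \<sigma> y)))"
    using J_le V_tl fin by (intro padic_exp_sum[OF card_ge_3]) (auto simp: B_def)
  also have "\<dots> = (\<Prod>y\<in>B. b powi (\<sigma> (tl (tl y)) * \<sigma> y))"
    using exp_mult_sign(2) sign V_tl by (intro prod.cong) (auto simp: B_def)
  also have "\<dots> = (\<Prod>y\<in>V. if length y \<ge> 2 then b powi (\<sigma> (tl (tl y)) * \<sigma> y) else 1)"
    using fin by (intro prod.mono_neutral_cong_left) (auto simp: B_def)
  finally show ?thesis unfolding vertex_weight_def V_def by (simp add: prod.distrib)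
qed

text \<open>For opposite spins the exponent -1 meets the field value 1, and for equal spins the
  exponent is 1. Each boundary factor is therefore the \<open>leaf_weight\<close> of the
  successor.\<close>

lemma gibbs_weight_sym_field:
  assumes "\<sigma> \<in> configs (tree_ball k (Suc n))"
  shows "gibbs_weight k J J1 (sym_field z) (Suc n) \<sigma>
    = (\<Prod>y\<in>tree_ball k (Suc n). vertex_weight \<sigma> y) * (\<Prod>y\<in>tree_sphere k (Suc n). leaf_weight \<sigma> y)"
proof -
  define f where "f x y = sym_field z x y (\<sigma> x) (\<sigma> y) powi (\<sigma> x * \<sigma> y)" for x y
  have f: "f x (i # x) = leaf_weight \<sigma> (i # x)" if "x \<in> tree_sphere k n" "i < k" for x i
  proof -
    have "x \<in> tree_ball k (Suc n)" "i # x \<in> tree_ball k (Suc n)"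
      using that by (auto simp: tree_sphere_eq tree_ball_eq)
    then show ?thesis
      using configs_values[OF assms, of x] configs_values[OF assms, of "i # x"]
      by (auto simp: f_def leaf_weight_def sym_field_def power_int_minus)
  qed
  have fin: "finite (successors k x)" if "x \<in> tree_sphere k n" for x
    using that by (simp add: tree_sphere_eq successors_eq)
  have "(\<Prod>(x, y)\<in>(SIGMA x:tree_sphere k n. successors k x). f x y)
      = (\<Prod>x\<in>tree_sphere k n. \<Prod>y\<in>successors k x. f x y)"
    using fin by (subst prod.Sigma) auto
  also have "\<dots> = (\<Prod>x\<in>tree_sphere k n. \<Prod>i<k. leaf_weight \<sigma> (i # x))"
  proof (rule prod.cong[OF refl])
    fix x assume x: "x \<in> tree_sphere k n"
    then have "successors k x = (\<lambda>i. i # x) ` {..<k}"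
      by (intro successors_eq) (simp add: tree_sphere_eq)
    then show "(\<Prod>y\<in>successors k x. f x y) = (\<Prod>i<k. leaf_weight \<sigma> (i # x))"
      using f[OF x] by (simp add: prod.reindex inj_on_def)
  qed
  also have "\<dots> = (\<Prod>y\<in>tree_sphere k (Suc n). leaf_weight \<sigma> y)"
    by (rule prod_tree_sphere_Suc[symmetric])
  finally show ?thesis
    unfolding gibbs_weight_def exp_hamiltonian[OF assms] by (simp add: f_def)
qed

text \<open>The sum over the spin \<open>u\<close> of the child \<open>i # x\<close> when all spins
  up to \<open>x\<close> are fixed. A child of the root has no grandparent bond.\<close>

definition child_sum :: "(vertex \<Rightarrow> int) \<Rightarrow> vertex \<Rightarrow> nat \<Rightarrow> 'p padic" where
  "child_sum \<sigma> x i = (\<Sum>u\<in>{-1, 1}. a powi (\<sigma> x * u) * (if x = [] then 1 else b powi (\<sigma> (tl x) * u))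
    * (if \<sigma> x = u then z (i # x) else 1))"

text \<open>Vertices of the last level interact only with their parent and grandparent, which lie in
  the inner ball. The weight is thus a product of functions of the single spins
  \<open>\<omega> y\<close>, and distributivity turns the sum over \<open>\<omega>\<close> into a
  product of one-spin sums.\<close>

lemma sum_gibbs_weight_merge:
  assumes \<sigma>: "\<sigma> \<in> configs (tree_ball k n)"
  defines "m \<equiv> \<lambda>\<omega>. merge (tree_ball k n) (tree_sphere k (Suc n)) (\<sigma>, \<omega>)"
  shows "(\<Sum>\<omega>\<in>configs (tree_sphere k (Suc n)). gibbs_weight k J J1 (sym_field z) (Suc n) (m \<omega>))
    = (\<Prod>y\<in>tree_ball k n. vertex_weight \<sigma> y) * (\<Prod>x\<in>tree_sphere k n. \<Prod>i<k. child_sum \<sigma> x i)"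
proof -
  define B where "B = tree_ball k n"
  define S where "S = tree_sphere k (Suc n)"
  define g where "g y u = a powi (\<sigma> (tl y) * u) * (if tl y = [] then 1 else b powi (\<sigma> (tl (tl y)) * u))
    * (if \<sigma> (tl y) = u then z y else 1)" for y u
  have BS: "B \<inter> S = {}" unfolding B_def S_def by (rule tree_ball_sphere_disjoint)
  have fin: "finite B" "finite S" by (simp_all add: B_def S_def)
  have "gibbs_weight k J J1 (sym_field z) (Suc n) (m \<omega>) = (\<Prod>y\<in>B. vertex_weight \<sigma> y) * (\<Prod>y\<in>S. g y (\<omega> y))"
    if \<omega>: "\<omega> \<in> configs S" for \<omega>
  proof -
    have m: "m \<omega> y = \<sigma> y" if "y \<in> B" for y using that BS by (simp add: m_def B_def S_def)
    have m': "m \<omega> y = \<omega> y" if "y \<in> S" for y using that BS by (simp add: m_def B_def S_def)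
    have "m \<omega> \<in> configs (tree_ball k (Suc n))"
      unfolding m_def tree_ball_Suc using configs_merge[OF tree_ball_sphere_disjoint \<sigma>] \<omega> by (simp add: S_def)
    then have "gibbs_weight k J J1 (sym_field z) (Suc n) (m \<omega>)
        = (\<Prod>y\<in>B \<union> S. vertex_weight (m \<omega>) y) * (\<Prod>y\<in>S. leaf_weight (m \<omega>) y)"
      by (simp only: gibbs_weight_sym_field tree_ball_Suc B_def S_def)
    also have "\<dots> = (\<Prod>y\<in>B. vertex_weight (m \<omega>) y) * (\<Prod>y\<in>S. vertex_weight (m \<omega>) y * leaf_weight (m \<omega>) y)"
      using BS fin by (simp add: prod.union_disjoint prod.distrib mult.assoc)
    also have "(\<Prod>y\<in>B. vertex_weight (m \<omega>) y) = (\<Prod>y\<in>B. vertex_weight \<sigma> y)"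
    proof (rule prod.cong[OF refl])
      fix y assume y: "y \<in> B"
      then have "tl y \<in> B" "tl (tl y) \<in> B" by (auto simp: B_def tree_ball_eq tree_vertices_tl)
      then show "vertex_weight (m \<omega>) y = vertex_weight \<sigma> y"
        using y by (simp add: vertex_weight_def m)
    qed
    also have "(\<Prod>y\<in>S. vertex_weight (m \<omega>) y * leaf_weight (m \<omega>) y) = (\<Prod>y\<in>S. g y (\<omega> y))"
    proof (rule prod.cong[OF refl])
      fix y assume y: "y \<in> S"
      then obtain i x where ix: "y = i # x" "x \<in> tree_sphere k n"
        by (auto simp: S_def tree_sphere_Suc)
      then have "x \<in> B" "tl x \<in> B" by (auto simp: B_def tree_ball_eq tree_sphere_eq tree_vertices_tl)
      moreover have "Suc 0 \<le> length x \<longleftrightarrow> x \<noteq> []" by (cases x) auto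
      ultimately show "vertex_weight (m \<omega>) y * leaf_weight (m \<omega>) y = g y (\<omega> y)"
        using m'[OF y] ix by (simp add: vertex_weight_def leaf_weight_def g_def m)
    qed
    finally show ?thesis .
  qed
  then have "(\<Sum>\<omega>\<in>configs S. gibbs_weight k J J1 (sym_field z) (Suc n) (m \<omega>))
      = (\<Prod>y\<in>B. vertex_weight \<sigma> y) * (\<Sum>\<omega>\<in>configs S. \<Prod>y\<in>S. g y (\<omega> y))"
    by (simp add: sum_distrib_left)
  also have "(\<Sum>\<omega>\<in>configs S. \<Prod>y\<in>S. g y (\<omega> y)) = (\<Prod>y\<in>S. \<Sum>u\<in>{-1, 1}. g y u)"
    unfolding configs_def using fin by (intro prod_sum_PiE[symmetric]) auto
  also have "\<dots> = (\<Prod>x\<in>tree_sphere k n. \<Prod>i<k. child_sum \<sigma> x i)"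
  proof -
    have "(\<Sum>u\<in>{-1, 1}. g (i # x) u) = child_sum \<sigma> x i" for x i
      unfolding child_sum_def by (intro sum.cong refl) (simp only: g_def list.sel)
    then show ?thesis unfolding S_def prod_tree_sphere_Suc by (simp only:)
  qed
  finally show ?thesis by (simp only: B_def S_def)
qed

end

text \<open>\<open>recursion\<close> is what compatibility requires, and the other two assumptions
  keep the partition functions nonzero. The root is treated apart: the children of the root lack a
  grandparent bond, which puts 1 in place of \<open>b\<^sup>2\<close>.\<close>

locale symmetric_solution = symmetric_model k J J1 a b z
  for k J J1 and a b :: "'p::prime_card padic" and z +
  assumes recursion: "\<And>y. y \<in> tree_vertices k \<Longrightarrow> y \<noteq> [] \<Longrightarrow>
      z y = (\<Prod>i<k. (a\<^sup>2 * b\<^sup>2 * z (i # y) + 1) / (a\<^sup>2 * z (i # y) + b\<^sup>2))"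
    and nonzero: "\<And>y. y \<in> tree_vertices k \<Longrightarrow> y \<noteq> [] \<Longrightarrow> a\<^sup>2 * z y + b\<^sup>2 \<noteq> 0"
    and root_nonzero: "\<And>i. i < k \<Longrightarrow> a\<^sup>2 * z [i] + 1 \<noteq> 0"
begin

lemma child_sum_root:
  assumes "\<sigma> [] = -1 \<or> \<sigma> [] = 1"
  shows "child_sum \<sigma> [] i = (a\<^sup>2 * z [i] + 1) / a"
  using assms by (auto simp: child_sum_def power_int_minus field_simps power2_eq_square)

text \<open>The one-spin sum takes two values, according to whether \<open>x\<close> and its parent
  agree. The value for disagreement is pulled out as a common factor, and the quotient of the two is
  what \<open>recursion\<close> multiplies over the children.\<close>

lemma child_sum_eq:
  assumes "\<sigma> x = -1 \<or> \<sigma> x = 1" "\<sigma> (tl x) = -1 \<or> \<sigma> (tl x) = 1" "x \<noteq> []"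
    and "x \<in> tree_vertices k" "i < k"
  defines "w \<equiv> z (i # x)"
  shows "child_sum \<sigma> x i = (a\<^sup>2 * w + b\<^sup>2) / (a * b)
    * (if \<sigma> (tl x) = \<sigma> x then (a\<^sup>2 * b\<^sup>2 * w + 1) / (a\<^sup>2 * w + b\<^sup>2) else 1)"
proof -
  have nz: "a\<^sup>2 * w + b\<^sup>2 \<noteq> 0" unfolding w_def using assms by (intro nonzero) auto
  have "child_sum \<sigma> x i = (if \<sigma> (tl x) = \<sigma> x then (a\<^sup>2 * b\<^sup>2 * w + 1) / (a * b)
      else (a\<^sup>2 * w + b\<^sup>2) / (a * b))"
    using assms(1-3) unfolding child_sum_def w_def[symmetric]
    by (auto simp: power_int_minus field_simps power2_eq_square)
  then show ?thesis using nz by simp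
qed

text \<open>For \<open>n \<ge> 1\<close> this is the ratio of the partition functions at levels
  \<open>n + 1\<close> and \<open>n\<close>. At \<open>n = 0\<close> it is not, because of the
  different factors at the root.\<close>

definition level_factor :: "nat \<Rightarrow> 'p padic" where
  "level_factor n = (\<Prod>y\<in>tree_sphere k (Suc n). (a\<^sup>2 * z y + b\<^sup>2) / (a * b))"

lemma level_factor_nonzero: "level_factor n \<noteq> 0"
proof -
  have "a\<^sup>2 * z y + b\<^sup>2 \<noteq> 0" if "y \<in> tree_sphere k (Suc n)" for y
    using that by (intro nonzero) (auto simp: tree_sphere_eq)
  then show ?thesis by (simp add: level_factor_def)
qed

text \<open>By \<open>recursion\<close>, the quotients from the children of \<open>x\<close>
  multiply to \<open>leaf_weight \<sigma> x\<close>, which restores the weight of the smaller ball;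
  the remaining common factors do not depend on \<open>\<sigma>\<close>. Both compatibility and the
  recursion for the partition function follow.\<close>

lemma sum_gibbs_weight_Suc:
  assumes "\<sigma> \<in> configs (tree_ball k (Suc n))"
  shows "(\<Sum>\<omega>\<in>configs (tree_sphere k (Suc (Suc n))).
      gibbs_weight k J J1 (sym_field z) (Suc (Suc n))
        (merge (tree_ball k (Suc n)) (tree_sphere k (Suc (Suc n))) (\<sigma>, \<omega>)))
    = gibbs_weight k J J1 (sym_field z) (Suc n) \<sigma> * level_factor (Suc n)"
proof -
  have "(\<Prod>i<k. child_sum \<sigma> x i) = leaf_weight \<sigma> x * (\<Prod>i<k. (a\<^sup>2 * z (i # x) + b\<^sup>2) / (a * b))"
    if x: "x \<in> tree_sphere k (Suc n)" for x
  proof -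
    have xV: "x \<in> tree_vertices k" "x \<noteq> []" "x \<in> tree_ball k (Suc n)" "tl x \<in> tree_ball k (Suc n)"
      using x by (auto simp: tree_sphere_eq tree_ball_eq tree_vertices_tl)
    define w where "w i = z (i # x)" for i
    have "(\<Prod>i<k. child_sum \<sigma> x i) = (\<Prod>i<k. (a\<^sup>2 * w i + b\<^sup>2) / (a * b)
        * (if \<sigma> (tl x) = \<sigma> x then (a\<^sup>2 * b\<^sup>2 * w i + 1) / (a\<^sup>2 * w i + b\<^sup>2) else 1))"
      unfolding w_def using xV configs_values[OF assms] by (intro prod.cong refl child_sum_eq) auto
    also have "\<dots> = (\<Prod>i<k. (a\<^sup>2 * w i + b\<^sup>2) / (a * b)) * leaf_weight \<sigma> x"
      unfolding prod.distrib using xV recursion[of x] by (simp add: leaf_weight_def w_def)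
    finally show ?thesis by (simp only: w_def mult.commute)
  qed
  then have "(\<Prod>x\<in>tree_sphere k (Suc n). \<Prod>i<k. child_sum \<sigma> x i)
      = (\<Prod>y\<in>tree_sphere k (Suc n). leaf_weight \<sigma> y) * level_factor (Suc n)"
    unfolding level_factor_def prod_tree_sphere_Suc[of _ _ "Suc n"] by (simp add: prod.distrib)
  then show ?thesis
    by (simp only: sum_gibbs_weight_merge[OF assms] gibbs_weight_sym_field[OF assms] mult.assoc)
qed

lemma partition_function_Suc:
  "partition_function k J J1 (sym_field z) (Suc (Suc n))
    = partition_function k J J1 (sym_field z) (Suc n) * level_factor (Suc n)"
  unfolding partition_function_def tree_ball_Suc[of k "Suc n"]
    sum_configs_Un[OF tree_ball_sphere_disjoint] sum_distrib_right
  by (intro sum.cong refl sum_gibbs_weight_Suc)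

text \<open>By spin-flip symmetry both spins at the root contribute the same product, whence the
  factor 2.\<close>

lemma partition_function_1:
  "partition_function k J J1 (sym_field z) (Suc 0) = 2 * (\<Prod>i<k. (a\<^sup>2 * z [i] + 1) / a)"
proof -
  have ball: "tree_ball k 0 = {[]}" and sphere: "tree_sphere k 0 = {[]}"
    by (auto simp: tree_ball_eq tree_sphere_eq)
  have "partition_function k J J1 (sym_field z) (Suc 0)
      = (\<Sum>\<sigma>\<in>configs (tree_ball k 0). \<Prod>i<k. (a\<^sup>2 * z [i] + 1) / a)"
    unfolding partition_function_def tree_ball_Suc[of k 0] sum_configs_Un[OF tree_ball_sphere_disjoint]
  proof (rule sum.cong[OF refl])
    fix \<sigma> assume \<sigma>: "\<sigma> \<in> configs (tree_ball k 0)"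
    show "(\<Sum>\<omega>\<in>configs (tree_sphere k (Suc 0)). gibbs_weight k J J1 (sym_field z) (Suc 0)
        (merge (tree_ball k 0) (tree_sphere k (Suc 0)) (\<sigma>, \<omega>))) = (\<Prod>i<k. (a\<^sup>2 * z [i] + 1) / a)"
      unfolding sum_gibbs_weight_merge[OF \<sigma>]
      using child_sum_root[of \<sigma>] configs_values[OF \<sigma>, of "[]"]
      by (simp add: ball sphere vertex_weight_def)
  qed
  also have "card (configs (tree_ball k 0)) = 2"
    unfolding configs_def ball by (subst card_PiE) auto
  then have "(\<Sum>\<sigma>\<in>configs (tree_ball k 0). \<Prod>i<k. (a\<^sup>2 * z [i] + 1) / a) = 2 * (\<Prod>i<k. (a\<^sup>2 * z [i] + 1) / a)"
    by simp
  finally show ?thesis .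
qed

lemma partition_function_eq:
  "partition_function k J J1 (sym_field z) (Suc n)
    = 2 * (\<Prod>i<k. (a\<^sup>2 * z [i] + 1) / a) * (\<Prod>j<n. level_factor (Suc j))"
  by (induction n) (simp_all add: partition_function_1 partition_function_Suc mult.assoc)

lemma partition_function_nonzero: "n \<ge> 1 \<Longrightarrow> partition_function k J J1 (sym_field z) n \<noteq> 0"
  using root_nonzero level_factor_nonzero by (cases n) (auto simp: partition_function_eq)

lemma sym_field_defined: "field_defined k J J1 (sym_field z)"
  using partition_function_nonzero by (auto simp: field_defined_def sym_field_def)

lemma sym_field_compatible: "compatible k J J1 (sym_field z)"
  unfolding compatible_def
proof (intro allI impI ballI)
  fix n \<sigma> assume "2 \<le> n" and \<sigma>: "\<sigma> \<in> configs (tree_ball k (n - 1))"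
  then obtain m where n: "n = Suc (Suc m)" by (metis add_2_eq_Suc le_Suc_ex)
  show "(\<Sum>\<omega>\<in>configs (tree_sphere k n). gibbs_finite k J J1 (sym_field z) n
      (merge (tree_ball k (n - 1)) (tree_sphere k n) (\<sigma>, \<omega>))) = gibbs_finite k J J1 (sym_field z) (n - 1) \<sigma>"
    using \<sigma> level_factor_nonzero[of "Suc m"]
    unfolding gibbs_finite_def sum_divide_distrib[symmetric] n diff_Suc_1
    by (simp only: sum_gibbs_weight_Suc partition_function_Suc) simp
qed

lemma norm_gibbs_finite:
  assumes "\<And>y. y \<in> tree_vertices k \<Longrightarrow> y \<noteq> [] \<Longrightarrow> padic_norm (z y) = 1"
    and "\<sigma> \<in> configs (tree_ball k (Suc n))"
  shows "padic_norm (gibbs_finite k J J1 (sym_field z) (Suc n) \<sigma>)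
    = 1 / padic_norm (partition_function k J J1 (sym_field z) (Suc n))"
proof -
  have powi: "padic_norm (c powi (\<sigma> x * \<sigma> y)) = 1"
    if "x \<in> tree_ball k (Suc n)" "y \<in> tree_ball k (Suc n)" "padic_norm c = 1" for c :: "'p padic" and x y
    using configs_values[OF assms(2) that(1)] configs_values[OF assms(2) that(2)] that(3)
    by (auto simp: power_int_minus padic_norm_inverse)
  have "padic_norm (vertex_weight \<sigma> y) = 1" if "y \<in> tree_ball k (Suc n)" for y
  proof -
    have "tl y \<in> tree_ball k (Suc n)" "tl (tl y) \<in> tree_ball k (Suc n)"
      using that by (auto simp: tree_ball_eq tree_vertices_tl)
    then show ?thesis using that powi norm_ab by (simp add: vertex_weight_def padic_norm_mult)
  qed
  moreover have "padic_norm (leaf_weight \<sigma> y) = 1" if "y \<in> tree_sphere k (Suc n)" for y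
    using that assms(1)[of y] by (cases y) (auto simp: leaf_weight_def tree_sphere_eq)
  ultimately show ?thesis
    unfolding gibbs_finite_def gibbs_weight_sym_field[OF assms(2)]
    by (simp add: padic_norm_divide padic_norm_mult padic_norm_prod)
qed

end


section \<open>The measure of a compatible field\<close>

lemma restrict_configs: "B \<subseteq> A \<Longrightarrow> \<sigma> \<in> configs A \<Longrightarrow> restrict \<sigma> B \<in> configs B"
  by (auto simp: configs_def PiE_iff)

lemma configs_extend:
  assumes "B \<subseteq> A" "\<sigma> \<in> configs B"
  obtains \<tau> where "\<tau> \<in> configs A" "restrict \<tau> B = \<sigma>"
proof
  show "(\<lambda>x\<in>A. if x \<in> B then \<sigma> x else 1) \<in> configs A"
    using assms by (auto simp: configs_def PiE_iff)
  show "restrict (\<lambda>x\<in>A. if x \<in> B then \<sigma> x else 1) B = \<sigma>"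
    using assms by (auto simp: configs_def PiE_iff extensional_def restrict_def fun_eq_iff)
qed

lemma restrict_restrict_subset: "B \<subseteq> A \<Longrightarrow> restrict (restrict f A) B = restrict f B"
  by (auto simp: restrict_def fun_eq_iff)

abbreviation ball_restrict :: "nat \<Rightarrow> nat \<Rightarrow> (vertex \<Rightarrow> int) \<Rightarrow> vertex \<Rightarrow> int" where
  "ball_restrict k n \<sigma> \<equiv> restrict \<sigma> (tree_ball k n)"

text \<open>Fixing the level \<open>n\<close> of a cylinder set allows two sets to be brought to a
  common level before they are combined.\<close>

definition determined_by_ball :: "nat \<Rightarrow> nat \<Rightarrow> (vertex \<Rightarrow> int) set \<Rightarrow> bool" where
  "determined_by_ball k n A \<longleftrightarrow> (\<exists>B \<subseteq> configs (tree_ball k n). A = cylinder k n B)"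

lemma cylinder_sets_iff: "A \<in> cylinder_sets k \<longleftrightarrow> (\<exists>n. determined_by_ball k n A)"
  by (auto simp: cylinder_sets_def determined_by_ball_def)

lemma ball_restrict_cylinder:
  assumes "B \<subseteq> configs (tree_ball k n)"
  shows "ball_restrict k n ` cylinder k n B = B"
proof (intro set_eqI iffI)
  fix \<sigma> assume "\<sigma> \<in> B"
  moreover from this obtain \<tau> where "\<tau> \<in> configs (tree_vertices k)" "ball_restrict k n \<tau> = \<sigma>"
    using configs_extend[OF tree_ball_subset] assms by blast
  ultimately show "\<sigma> \<in> ball_restrict k n ` cylinder k n B" by (force simp: cylinder_def)
qed (auto simp: cylinder_def)

text \<open>A description without the base \<open>B\<close>, as saturation under agreement on the
  ball; in this form unions, complements and a larger level are immediate.\<close>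

lemma determined_by_ball_iff:
  "determined_by_ball k n A \<longleftrightarrow> A \<subseteq> configs (tree_vertices k) \<and>
    (\<forall>\<sigma>\<in>A. \<forall>\<tau>\<in>configs (tree_vertices k). ball_restrict k n \<sigma> = ball_restrict k n \<tau> \<longrightarrow> \<tau> \<in> A)"
  (is "?L \<longleftrightarrow> ?R")
proof
  assume ?L
  then obtain B where B: "A = cylinder k n B" unfolding determined_by_ball_def by blast
  show ?R
  proof (intro conjI ballI impI)
    fix \<sigma> \<tau> assume "\<sigma> \<in> A" and \<tau>: "\<tau> \<in> configs (tree_vertices k)"
      and eq: "ball_restrict k n \<sigma> = ball_restrict k n \<tau>"
    then have "ball_restrict k n \<sigma> \<in> B" by (simp add: B cylinder_def)
    then show "\<tau> \<in> A" using \<tau> unfolding B cylinder_def eq by simp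
  qed (auto simp: B cylinder_def)
next
  assume R: ?R
  have "A = cylinder k n (ball_restrict k n ` A)"
  proof (intro set_eqI iffI)
    fix \<tau> assume "\<tau> \<in> A"
    moreover from this have "\<tau> \<in> configs (tree_vertices k)" using R by blast
    ultimately show "\<tau> \<in> cylinder k n (ball_restrict k n ` A)" by (simp add: cylinder_def)
  next
    fix \<tau> assume "\<tau> \<in> cylinder k n (ball_restrict k n ` A)"
    then obtain \<sigma> where "\<tau> \<in> configs (tree_vertices k)" "\<sigma> \<in> A" "ball_restrict k n \<sigma> = ball_restrict k n \<tau>"
      by (auto simp: cylinder_def)
    then show "\<tau> \<in> A" using R by blast
  qed
  moreover have "ball_restrict k n ` A \<subseteq> configs (tree_ball k n)"
    using R restrict_configs[OF tree_ball_subset] by blast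
  ultimately show ?L unfolding determined_by_ball_def by blast
qed

lemma determined_by_ball_mono:
  assumes "determined_by_ball k m A" "m \<le> n"
  shows "determined_by_ball k n A"
proof -
  have "ball_restrict k m \<sigma> = ball_restrict k m \<tau>" if "ball_restrict k n \<sigma> = ball_restrict k n \<tau>" for \<sigma> \<tau>
    using arg_cong[OF that, of "ball_restrict k m"]
    by (simp only: restrict_restrict_subset[OF tree_ball_mono[OF assms(2)]])
  then show ?thesis using assms(1) unfolding determined_by_ball_iff by blast
qed

lemma determined_by_ball_Un:
  assumes "determined_by_ball k n A" "determined_by_ball k n C"
  shows "determined_by_ball k n (A \<union> C)"
  using assms unfolding determined_by_ball_iff by (metis Un_iff Un_subset_iff)

lemma determined_by_ball_compl:
  assumes "determined_by_ball k n A"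
  shows "determined_by_ball k n (configs (tree_vertices k) - A)"
  unfolding determined_by_ball_iff
proof (intro conjI ballI impI)
  fix \<sigma> \<tau> assume "\<sigma> \<in> configs (tree_vertices k) - A" "\<tau> \<in> configs (tree_vertices k)"
    "ball_restrict k n \<sigma> = ball_restrict k n \<tau>"
  then show "\<tau> \<in> configs (tree_vertices k) - A"
    using assms unfolding determined_by_ball_iff by (metis Diff_iff)
qed simp

lemma cylinder_sets_common:
  assumes "A \<in> cylinder_sets k" "C \<in> cylinder_sets k"
  obtains n where "n \<ge> 1" "determined_by_ball k n A" "determined_by_ball k n C"
proof -
  obtain i j where "determined_by_ball k i A" "determined_by_ball k j C"
    using assms by (auto simp: cylinder_sets_iff)
  then have "determined_by_ball k (Suc (max i j)) A" "determined_by_ball k (Suc (max i j)) C"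
    by (simp_all add: determined_by_ball_mono)
  then show ?thesis using that[of "Suc (max i j)"] by simp
qed

lemma algebra_cylinder_sets: "algebra (configs (tree_vertices k)) (cylinder_sets k)"
  unfolding algebra_iff_Un
proof (intro conjI ballI)
  show "cylinder_sets k \<subseteq> Pow (configs (tree_vertices k))"
    by (auto simp: cylinder_sets_iff determined_by_ball_iff)
  show "{} \<in> cylinder_sets k"
    by (auto simp: cylinder_sets_iff determined_by_ball_iff)
next
  fix A assume "A \<in> cylinder_sets k"
  then show "configs (tree_vertices k) - A \<in> cylinder_sets k"
    using determined_by_ball_compl unfolding cylinder_sets_iff by blast
next
  fix A C assume "A \<in> cylinder_sets k" "C \<in> cylinder_sets k"
  then obtain n where "determined_by_ball k n A" "determined_by_ball k n C"
    by (rule cylinder_sets_common)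
  then show "A \<union> C \<in> cylinder_sets k"
    using determined_by_ball_Un unfolding cylinder_sets_iff by blast
qed

section \<open>Construction of the measure from a compatible field\<close>

locale compatible_field =
  fixes k :: nat and J J1 :: "'p::prime_card padic" and h :: "'p boundary_field"
  assumes defined: "field_defined k J J1 h" and compat: "compatible k J J1 h"
begin

definition ball_measure :: "nat \<Rightarrow> (vertex \<Rightarrow> int) set \<Rightarrow> 'p padic" where
  "ball_measure n A = (\<Sum>\<sigma>\<in>ball_restrict k n ` A. gibbs_finite k J J1 h n \<sigma>)"

text \<open>Since membership in \<open>A\<close> depends only on the smaller ball, its restrictions
  to the larger ball are its restrictions to the smaller one with arbitrary spins on the new sphere.
  Compatibility sums out the latter.\<close>

lemma ball_measure_Suc:
  assumes "n \<ge> 1" "determined_by_ball k n A"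
  shows "ball_measure (Suc n) A = ball_measure n A"
proof -
  define B where "B = tree_ball k n"
  define S where "S = tree_sphere k (Suc n)"
  have BS: "B \<inter> S = {}" unfolding B_def S_def by (rule tree_ball_sphere_disjoint)
  have ball: "tree_ball k (Suc n) = B \<union> S" unfolding B_def S_def by (rule tree_ball_Suc)
  have A: "A \<subseteq> configs (tree_vertices k)"
    "\<And>\<sigma> \<tau>. \<sigma> \<in> A \<Longrightarrow> \<tau> \<in> configs (tree_vertices k) \<Longrightarrow> restrict \<sigma> B = restrict \<tau> B \<Longrightarrow> \<tau> \<in> A"
    using assms(2) unfolding determined_by_ball_iff B_def by blast+
  define R where "R = (\<lambda>\<sigma>. restrict \<sigma> B) ` A"
  have R: "R \<subseteq> configs B"
    unfolding R_def B_def using A(1) restrict_configs[OF tree_ball_subset] by blast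
  have "ball_measure (Suc n) A = (\<Sum>q\<in>R \<times> configs S. gibbs_finite k J J1 h (Suc n) (merge B S q))"
    unfolding ball_measure_def ball
  proof (rule sum.reindex_bij_witness[where i = "merge B S" and j = "\<lambda>\<tau>. (restrict \<tau> B, restrict \<tau> S)"])
    fix \<tau> assume "\<tau> \<in> (\<lambda>\<sigma>. restrict \<sigma> (B \<union> S)) ` A"
    then obtain \<sigma> where \<sigma>: "\<sigma> \<in> A" "\<tau> = restrict \<sigma> (B \<union> S)" by blast
    show *: "merge B S (restrict \<tau> B, restrict \<tau> S) = \<tau>"
      by (simp add: \<sigma>)
    have "restrict \<tau> B = restrict \<sigma> B" "restrict \<tau> S = restrict \<sigma> S"
      by (auto simp: \<sigma> restrict_restrict_subset)
    moreover have "restrict \<sigma> S \<in> configs S"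
      using A(1) \<sigma>(1) by (intro restrict_configs[of S "tree_vertices k"]) (auto simp: S_def tree_sphere_eq)
    ultimately show "(restrict \<tau> B, restrict \<tau> S) \<in> R \<times> configs S"
      using \<sigma>(1) by (auto simp: R_def)
    show "gibbs_finite k J J1 h (Suc n) (merge B S (restrict \<tau> B, restrict \<tau> S)) = gibbs_finite k J J1 h (Suc n) \<tau>"
      by (simp only: *)
  next
    fix q assume q: "q \<in> R \<times> configs S"
    then obtain \<rho> \<omega> where \<rho>: "q = (\<rho>, \<omega>)" "\<rho> \<in> R" "\<omega> \<in> configs S" by blast
    then have mem: "merge B S q \<in> configs (B \<union> S)" using configs_merge[OF BS] R by blast
    \<comment> \<open>The merged configuration is extended to the whole tree; the extension agrees
      on \<open>B\<close> with some \<open>\<sigma> \<in> A\<close> and hence lies in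
      \<open>A\<close>.\<close>
    then obtain \<tau> where \<tau>: "\<tau> \<in> configs (tree_vertices k)" "restrict \<tau> (B \<union> S) = merge B S q"
      by (rule configs_extend[OF tree_ball_subset[of k "Suc n", unfolded ball]])
    have \<rho>': "restrict \<rho> B = \<rho>" "restrict \<omega> S = \<omega>" using \<rho> R by (auto simp: configs_def)
    then show "(restrict (merge B S q) B, restrict (merge B S q) S) = q"
      using BS by (simp add: \<rho>(1))
    obtain \<sigma> where \<sigma>: "\<sigma> \<in> A" "\<rho> = restrict \<sigma> B" using \<rho> by (auto simp: R_def)
    have "restrict \<tau> B = restrict (restrict \<tau> (B \<union> S)) B"
      by (simp add: restrict_restrict_subset)
    also have "\<dots> = restrict \<sigma> B" unfolding \<tau>(2) \<rho>(1) using BS by (simp add: \<sigma>(2))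
    finally have "restrict \<sigma> B = restrict \<tau> B" by (rule sym)
    then have "\<tau> \<in> A" by (rule A(2)[OF \<sigma>(1) \<tau>(1)])
    then show "merge B S q \<in> (\<lambda>\<sigma>. restrict \<sigma> (B \<union> S)) ` A" unfolding \<tau>(2)[symmetric] by (rule imageI)
  qed
  also have "\<dots> = (\<Sum>\<sigma>\<in>R. \<Sum>\<omega>\<in>configs S. gibbs_finite k J J1 h (Suc n) (merge B S (\<sigma>, \<omega>)))"
    by (simp add: sum.cartesian_product case_prod_unfold)
  also have "\<dots> = (\<Sum>\<sigma>\<in>R. gibbs_finite k J J1 h n \<sigma>)"
  proof (rule sum.cong[OF refl])
    fix \<sigma> assume "\<sigma> \<in> R"
    then have "\<sigma> \<in> configs (tree_ball k (Suc n - 1))" using R by (auto simp: B_def)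
    moreover have "2 \<le> Suc n" using assms(1) by simp
    ultimately have "(\<Sum>\<omega>\<in>configs (tree_sphere k (Suc n)). gibbs_finite k J J1 h (Suc n)
        (merge (tree_ball k (Suc n - 1)) (tree_sphere k (Suc n)) (\<sigma>, \<omega>))) = gibbs_finite k J J1 h (Suc n - 1) \<sigma>"
      using compat unfolding compatible_def by blast
    then show "(\<Sum>\<omega>\<in>configs S. gibbs_finite k J J1 h (Suc n) (merge B S (\<sigma>, \<omega>))) = gibbs_finite k J J1 h n \<sigma>"
      by (simp add: B_def S_def)
  qed
  finally show ?thesis unfolding ball_measure_def R_def B_def .
qed

lemma ball_measure_mono:
  assumes "m \<ge> 1" "determined_by_ball k m A" "m \<le> n"
  shows "ball_measure n A = ball_measure m A"
  using \<open>m \<le> n\<close>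
proof (induction n rule: dec_induct)
  case (step n)
  then show ?case
    using assms ball_measure_Suc[of n A] determined_by_ball_mono[OF assms(2), of n] by simp
qed simp

text \<open>The least level only selects one among levels that all give the same value. Level 0 is
  excluded because the finite-volume measures start at 1.\<close>

definition field_measure :: "(vertex \<Rightarrow> int) set \<Rightarrow> 'p padic" where
  "field_measure A = ball_measure (LEAST n. n \<ge> 1 \<and> determined_by_ball k n A) A"

lemma field_measure_eq:
  assumes "n \<ge> 1" "determined_by_ball k n A"
  shows "field_measure A = ball_measure n A"
proof -
  define m where "m = (LEAST n. n \<ge> 1 \<and> determined_by_ball k n A)"
  have "m \<ge> 1 \<and> determined_by_ball k m A" "m \<le> n"
    unfolding m_def using assms by (auto intro: LeastI2 Least_le)
  then show ?thesis
    using ball_measure_mono[of m A n] by (simp add: field_measure_def m_def)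
qed

lemma field_measure_cylinder:
  assumes "n \<ge> 1" "B \<subseteq> configs (tree_ball k n)"
  shows "field_measure (cylinder k n B) = (\<Sum>\<sigma>\<in>B. gibbs_finite k J J1 h n \<sigma>)"
  using assms field_measure_eq[of n "cylinder k n B"]
  by (auto simp: determined_by_ball_def ball_measure_def ball_restrict_cylinder)

lemma field_measure_Un:
  assumes "A \<in> cylinder_sets k" "C \<in> cylinder_sets k" "A \<inter> C = {}"
  shows "field_measure (A \<union> C) = field_measure A + field_measure C"
proof -
  obtain n where n: "n \<ge> 1" "determined_by_ball k n A" "determined_by_ball k n C"
    using assms(1,2) by (rule cylinder_sets_common)
  have sub: "ball_restrict k n ` A \<subseteq> configs (tree_ball k n)" "ball_restrict k n ` C \<subseteq> configs (tree_ball k n)"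
    using n restrict_configs[OF tree_ball_subset] unfolding determined_by_ball_iff by blast+
  then have fin: "finite (ball_restrict k n ` A)" "finite (ball_restrict k n ` C)"
    using finite_subset[OF _ finite_configs[OF finite_tree_ball]] by blast+
  have "ball_restrict k n ` A \<inter> ball_restrict k n ` C = {}"
  proof (rule ccontr)
    assume "ball_restrict k n ` A \<inter> ball_restrict k n ` C \<noteq> {}"
    then obtain \<sigma> \<tau> where "\<sigma> \<in> A" "\<tau> \<in> C" "ball_restrict k n \<sigma> = ball_restrict k n \<tau>" by blast
    moreover from this have "\<tau> \<in> A"
      using n(2,3) unfolding determined_by_ball_iff by blast
    ultimately show False using assms(3) by blast
  qed
  then show ?thesis
    using n determined_by_ball_Un[OF n(2,3)] fin
    by (simp add: field_measure_eq[of n] ball_measure_def image_Un sum.union_disjoint)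
qed

lemma field_measure_total: "field_measure (configs (tree_vertices k)) = 1"
proof -
  have eq: "configs (tree_vertices k) = cylinder k 1 (configs (tree_ball k 1))"
    using restrict_configs[OF tree_ball_subset] by (auto simp: cylinder_def)
  have "partition_function k J J1 h 1 \<noteq> 0" using defined by (simp add: field_defined_def)
  then show ?thesis
    unfolding eq by (subst field_measure_cylinder)
      (auto simp: gibbs_finite_def partition_function_def sum_divide_distrib[symmetric])
qed

lemma quasi_gibbs_field_measure: "quasi_gibbs_measure k J J1 field_measure"
  unfolding quasi_gibbs_measure_def padic_probability_measure_def padic_measure_def
  using algebra_cylinder_sets field_measure_Un field_measure_total defined compat
  by (auto simp: field_measure_cylinder intro!: exI[of _ h])

text \<open>By the ultrametric inequality a sum is no larger than its largest term, so a bound on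
  single configurations bounds all cylinder sets.\<close>

lemma field_measure_bounded:
  assumes "\<And>n \<sigma>. n \<ge> 1 \<Longrightarrow> \<sigma> \<in> configs (tree_ball k n) \<Longrightarrow> padic_norm (gibbs_finite k J J1 h n \<sigma>) \<le> c"
  shows "padic_bounded (cylinder_sets k) field_measure"
  unfolding padic_bounded_def
proof (rule bdd_aboveI2)
  fix A assume "A \<in> cylinder_sets k"
  then obtain n where n: "n \<ge> 1" "determined_by_ball k n A"
    using cylinder_sets_common by blast
  then have "ball_restrict k n ` A \<subseteq> configs (tree_ball k n)"
    using restrict_configs[OF tree_ball_subset] unfolding determined_by_ball_iff by blast
  \<comment> \<open>Some configuration exists, being an extension of the only element of
    \<open>configs {}\<close>; it yields \<open>0 \<le> c\<close>, as required for the empty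
    sum.\<close>
  moreover obtain \<sigma> where "\<sigma> \<in> configs (tree_ball k n)"
    using configs_extend[of "{}" "tree_ball k n" "\<lambda>_. undefined"] by (auto simp: configs_def)
  then have "0 \<le> c" using assms[OF n(1)] padic_norm_nonneg order_trans by blast
  ultimately show "padic_norm (field_measure A) \<le> c"
    unfolding field_measure_eq[OF n] ball_measure_def using assms[OF n(1)]
    by (intro padic_norm_sum_le) auto
qed

lemma field_measure_unbounded:
  assumes "\<And>c. \<exists>n\<ge>1. \<exists>\<sigma>\<in>configs (tree_ball k n). padic_norm (gibbs_finite k J J1 h n \<sigma>) > c"
  shows "\<not> padic_bounded (cylinder_sets k) field_measure"
proof
  assume "padic_bounded (cylinder_sets k) field_measure"
  then obtain c where c: "\<And>A. A \<in> cylinder_sets k \<Longrightarrow> padic_norm (field_measure A) \<le> c"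
    by (auto simp: padic_bounded_def bdd_above_def)
  obtain n \<sigma> where n: "n \<ge> 1" "\<sigma> \<in> configs (tree_ball k n)" "padic_norm (gibbs_finite k J J1 h n \<sigma>) > c"
    using assms by blast
  then have "cylinder k n {\<sigma>} \<in> cylinder_sets k" by (auto simp: cylinder_sets_def)
  then show False using c[of "cylinder k n {\<sigma>}"] n by (simp add: field_measure_cylinder)
qed

end


section \<open>The two solutions\<close>

definition edge_map :: "'a::field \<Rightarrow> 'a \<Rightarrow> 'a \<Rightarrow> 'a" where
  "edge_map A B z = (A * B * z + 1) / (A * z + B)"

definition edge_inv :: "'a::field \<Rightarrow> 'a \<Rightarrow> 'a \<Rightarrow> 'a" where
  "edge_inv A B w = (B * w - 1) / (A * (B - w))"

text \<open>The first and third identities are the denominator and numerator of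
  \<open>edge_map\<close> at the preimage of \<open>w\<close>, with quotient \<open>w\<close>; the
  first also gives the size of a level factor. The second gives the root factor and the closeness of
  the preimage to -1.\<close>

lemma edge_inv_identities:
  fixes A B w :: "'a::field"
  assumes "A \<noteq> 0" "B - w \<noteq> 0"
  shows "A * edge_inv A B w + B = (B\<^sup>2 - 1) / (B - w)"
    and "A * edge_inv A B w + 1 = (B - 1) * (w + 1) / (B - w)"
    and "A * B * edge_inv A B w + 1 = w * (B\<^sup>2 - 1) / (B - w)"
proof -
  have A: "A * edge_inv A B w = (B * w - 1) / (B - w)"
    using assms(1) by (simp add: edge_inv_def)
  then have AB: "A * B * edge_inv A B w = B * ((B * w - 1) / (B - w))"
    by (metis mult.assoc mult.commute)
  show "A * edge_inv A B w + B = (B\<^sup>2 - 1) / (B - w)"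
    "A * edge_inv A B w + 1 = (B - 1) * (w + 1) / (B - w)"
    "A * B * edge_inv A B w + 1 = w * (B\<^sup>2 - 1) / (B - w)"
    unfolding A AB times_divide_eq_right divide_add_eq_iff[OF assms(2)]
    by (rule arg_cong[where f = "\<lambda>x. x / (B - w)"], simp add: algebra_simps power2_eq_square)+
qed

lemma edge_map_edge_inv:
  fixes A B w :: "'a::field"
  assumes "A \<noteq> 0" "B - w \<noteq> 0" "B\<^sup>2 \<noteq> 1"
  shows "edge_map A B (edge_inv A B w) = w"
  using assms unfolding edge_map_def edge_inv_identities[OF assms(1,2)] by simp

locale near_one =
  fixes A B :: "'p::prime_card padic"
  assumes card_ge_3: "CARD('p) \<ge> 3"
    and A_near: "padic_norm (A - 1) \<le> 1 / real CARD('p)"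
    and B_near: "padic_norm (B - 1) \<le> 1 / real CARD('p)"
    and B_neq: "B \<noteq> 1"
begin

lemma inverse_card: "1 / real CARD('p) < 1"
  using card_ge_3 by simp

lemma norm_2 [simp]: "padic_norm (2 :: 'p padic) = 1"
  using card_ge_3 by (intro padic_norm_numeral_eq_1) (auto dest: dvd_imp_le)

lemma norm_AB [simp]: "padic_norm A = 1" "padic_norm B = 1"
  using padic_norm_eqI[of A 1] padic_norm_eqI[of B 1] A_near B_near inverse_card by auto

lemma AB_nonzero [simp]: "A \<noteq> 0" "B \<noteq> 0"
  using norm_AB padic_norm_0 by (metis zero_neq_one)+

lemma norm_B_sq: "padic_norm (B\<^sup>2 - 1) = padic_norm (B - 1)"
proof -
  have "padic_norm ((B + 1) - 2) < padic_norm (2 :: 'p padic)"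
    using B_near inverse_card by simp
  then have "padic_norm (B + 1) = 1" using padic_norm_eqI by fastforce
  moreover have "B\<^sup>2 - 1 = (B - 1) * (B + 1)" by (simp add: power2_eq_square algebra_simps)
  ultimately show ?thesis by (simp only: padic_norm_mult mult_1_right)
qed

lemma B_sq_neq: "B\<^sup>2 \<noteq> 1"
  using norm_B_sq B_neq by (metis padic_norm_eq_0_iff right_minus_eq)

text \<open>Both \<open>A * z + B\<close> and \<open>A * z + 1\<close> are close to 2, a unit as p
  is odd, and \<open>edge_map A B z - 1\<close> equals
  \<open>(B - 1) * (A * z - 1) / (A * z + B)\<close>.\<close>

lemma edge_map_near_one:
  assumes z: "padic_norm (z - 1) \<le> 1 / real CARD('p)"
  shows "padic_norm (A * z + B) = 1" "padic_norm (A * z + 1) = 1"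
    "padic_norm (edge_map A B z - 1) \<le> 1 / real CARD('p)"
proof -
  have "padic_norm (A * (z - 1)) \<le> 1 / real CARD('p)" using z by (simp add: padic_norm_mult)
  then have "padic_norm (A * (z - 1) + (A - 1)) \<le> 1 / real CARD('p)"
    using A_near by (rule padic_norm_add_le)
  then have Az: "padic_norm (A * z - 1) \<le> 1 / real CARD('p)" by (simp add: algebra_simps)
  have "padic_norm ((A * z - 1) + (B - 1)) \<le> 1 / real CARD('p)"
    using Az B_near by (rule padic_norm_add_le)
  then have "padic_norm (A * z + B - 2) < padic_norm (2 :: 'p padic)"
    using inverse_card by (simp add: algebra_simps)
  then show AzB: "padic_norm (A * z + B) = 1" using padic_norm_eqI by fastforce
  have "padic_norm (A * z + 1 - 2) < padic_norm (2 :: 'p padic)"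
    using Az inverse_card by simp
  then show "padic_norm (A * z + 1) = 1" using padic_norm_eqI by fastforce
  have "A * z + B \<noteq> 0" using AzB by auto
  then have "edge_map A B z - 1 = (B - 1) * (A * z - 1) / (A * z + B)"
    by (simp add: edge_map_def field_simps)
  moreover have "padic_norm (B - 1) * padic_norm (A * z - 1) \<le> 1 / real CARD('p) * 1"
    using Az B_near inverse_card by (intro mult_mono) auto
  ultimately show "padic_norm (edge_map A B z - 1) \<le> 1 / real CARD('p)"
    using AzB by (simp add: padic_norm_divide padic_norm_mult)
qed

text \<open>The map is a fractional linear one of determinant \<open>A * (B\<^sup>2 - 1)\<close>,
  which is small, while the denominators are units.\<close>

lemma edge_map_contraction:
  assumes x: "padic_norm (x - 1) \<le> 1 / real CARD('p)" and y: "padic_norm (y - 1) \<le> 1 / real CARD('p)"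
  shows "padic_norm (edge_map A B x - edge_map A B y) \<le> 1 / real CARD('p) * padic_norm (x - y)"
proof -
  have n: "padic_norm (A * x + B) = 1" "padic_norm (A * y + B) = 1"
    using edge_map_near_one x y by auto
  then have "A * x + B \<noteq> 0" "A * y + B \<noteq> 0" by auto
  then have "edge_map A B x - edge_map A B y = A * (B\<^sup>2 - 1) * (x - y) / ((A * x + B) * (A * y + B))"
    by (simp add: edge_map_def divide_simps) (simp add: algebra_simps power2_eq_square)
  then have "padic_norm (edge_map A B x - edge_map A B y) = padic_norm (B - 1) * padic_norm (x - y)"
    by (simp add: padic_norm_divide padic_norm_mult n norm_B_sq)
  then show ?thesis using mult_right_mono[OF B_near padic_norm_nonneg] by simp
qed

text \<open>Banach's theorem on the closed ball of radius 1/p around 1; taking k-th powers does not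
  increase distances between integral elements.\<close>

lemma fixed_point_near_one:
  obtains z where "padic_norm (z - 1) \<le> 1 / real CARD('p)" "edge_map A B z ^ k = z"
proof -
  define S where "S = {z :: 'p padic. padic_norm (z - 1) \<le> 1 / real CARD('p)}"
  have S: "S = cball 1 (1 / real CARD('p))"
    by (auto simp: S_def dist_padic_def padic_norm_diff_commute)
  have near: "padic_norm (edge_map A B x) \<le> 1" if "x \<in> S" for x
    using padic_norm_add_le[of "edge_map A B x - 1" 1 1] edge_map_near_one(3)[of x] that inverse_card
    by (simp add: S_def)
  have "\<exists>!z\<in>S. edge_map A B z ^ k = z"
  proof (rule Banach_fix)
    show "complete S" unfolding S by (simp add: complete_eq_closed)
    show "S \<noteq> {}" by (auto simp: S)
    show "0 \<le> 1 / real CARD('p)" "1 / real CARD('p) < 1" using inverse_card by auto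
    show "(\<lambda>z. edge_map A B z ^ k) ` S \<subseteq> S"
    proof clarify
      fix x assume "x \<in> S"
      then show "edge_map A B x ^ k \<in> S"
        using padic_norm_power_diff_le[of "edge_map A B x" 1 k] near edge_map_near_one(3)[of x]
        by (simp add: S_def)
    qed
    fix x y assume xy: "x \<in> S" "y \<in> S"
    have "dist (edge_map A B x ^ k) (edge_map A B y ^ k) \<le> padic_norm (edge_map A B x - edge_map A B y)"
      unfolding dist_padic_def using near xy by (intro padic_norm_power_diff_le) auto
    also have "\<dots> \<le> 1 / real CARD('p) * dist x y"
      unfolding dist_padic_def using xy by (intro edge_map_contraction) (auto simp: S_def)
    finally show "dist (edge_map A B x ^ k) (edge_map A B y ^ k) \<le> 1 / real CARD('p) * dist x y" .
  qed
  then show ?thesis using that by (auto simp: S_def)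
qed

text \<open>The hypotheses say that \<open>w\<close> is a unit not congruent to 1 mod p. As
  \<open>B\<close> is congruent to 1, \<open>B - w\<close> is a unit, so
  \<open>A * edge_inv A B w + 1\<close> is a multiple of \<open>B - 1\<close> by an integral
  element; finally \<open>A\<close> is congruent to 1.\<close>

lemma edge_inv_near_minus_one:
  assumes w: "padic_norm w = 1" "padic_norm (w - 1) = 1"
  shows "padic_norm (B - w) = 1" "padic_norm (edge_inv A B w + 1) < 1"
proof -
  have "padic_norm ((1 - w) + (B - 1)) = padic_norm (1 - w)"
    using w B_near inverse_card by (intro padic_norm_add_eq) (simp add: padic_norm_diff_commute)
  then show Bw: "padic_norm (B - w) = 1" using w by (simp add: padic_norm_diff_commute)
  then have nz: "B - w \<noteq> 0" by auto
  have "padic_norm (A * edge_inv A B w + 1) = padic_norm (B - 1) * padic_norm (w + 1)"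
    unfolding edge_inv_identities(2)[OF AB_nonzero(1) nz] by (simp add: padic_norm_divide padic_norm_mult Bw)
  also have "\<dots> \<le> padic_norm (B - 1) * 1"
    using w by (intro mult_left_mono padic_norm_add_le) auto
  also have "\<dots> < 1" using B_near inverse_card by simp
  finally have 1: "padic_norm (A * edge_inv A B w + 1) < 1" .
  have "padic_norm (B * w - 1) \<le> 1"
    using w by (intro padic_norm_diff_le) (auto simp: padic_norm_mult)
  then have "padic_norm (edge_inv A B w) \<le> 1"
    by (simp add: edge_inv_def padic_norm_divide padic_norm_mult Bw)
  then have "padic_norm ((A - 1) * edge_inv A B w) \<le> padic_norm (A - 1)"
    by (simp add: padic_norm_mult mult_left_le)
  also have "\<dots> < 1" using A_near inverse_card by simp
  finally have "padic_norm ((A * edge_inv A B w + 1) - (A - 1) * edge_inv A B w) < 1"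
    using 1 by (intro padic_norm_diff_less)
  then show "padic_norm (edge_inv A B w + 1) < 1" by (simp add: algebra_simps)
qed

end

text \<open>For odd \<open>k\<close> the factors are \<open>t\<close> and an even number of -1. For
  even \<open>k\<close> they are \<open>t / 2\<close>, 2 and an even number of -1; then
  \<open>t / 2 - 1\<close> is close to \<open>- 3 / 2\<close>, a unit for \<open>p \<ge> 5\<close>.
  For p = 3 and even \<open>k\<close> all residues would be -1, with product 1 instead of
  -1.\<close>

lemma unit_factorization:
  fixes t :: "'p::prime_card padic" and k :: nat
  assumes card: "CARD('p) \<ge> 3" and k: "k \<ge> 1" "odd k \<or> CARD('p) \<ge> 5"
    and t: "padic_norm (t + 1) < 1"
  obtains w where "(\<Prod>i<k. w i) = t" "\<And>i. padic_norm (w i) = 1" "\<And>i. padic_norm (w i - 1) = 1"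
proof -
  have numeral: "padic_norm (numeral n :: 'p padic) = 1" if "numeral n < CARD('p)" for n
    using that by (intro padic_norm_numeral_eq_1) (auto dest: dvd_imp_le)
  \<comment> \<open>As \<open>t + 1\<close> is small, subtracting a unit leaves a unit:
    \<open>c = 1\<close> gives \<open>t\<close>, \<open>c = 2\<close> gives \<open>t - 1\<close>,
    and \<open>c = 3\<close> serves for \<open>t / 2 - 1\<close>.\<close>
  have shift: "padic_norm ((t + 1) - c) = padic_norm c" if "padic_norm c = 1" for c
    using padic_norm_add_eq[of "t + 1" "- c"] t that by simp
  have t1: "padic_norm t = 1" using shift[of 1] by simp
  have t2: "padic_norm (t - 1) = 1" using shift[of 2] numeral[of "num.Bit0 num.One"] card by simp
  have m1: "padic_norm (- 1 - 1 :: 'p padic) = 1"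
    using numeral[of "num.Bit0 num.One"] card padic_norm_minus[of "2 :: 'p padic"] by simp
  show ?thesis
  proof (cases "odd k")
    case True
    then obtain m where m: "k = Suc m" "even m" by (cases k) auto
    show ?thesis
    proof
      show "(\<Prod>i<k. if i = 0 then t else -1) = t"
        unfolding m(1) prod.lessThan_Suc_shift using m(2) by simp
    qed (use t1 t2 m1 in auto)
  next
    case False
    then obtain m where m: "k = Suc (Suc m)" "even m"
      using k(1) by (cases k rule: old.nat.exhaust[case_product old.nat.exhaust[of "k - 1"]]) auto
    have p5: "CARD('p) \<ge> 5" using False k(2) by simp
    have n2: "padic_norm (2 :: 'p padic) = 1" and n3: "padic_norm (3 :: 'p padic) = 1"
      using numeral p5 by auto
    have "t / 2 - 1 = ((t + 1) - 3) / 2" by (simp add: field_simps)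
    then have t3: "padic_norm (t / 2 - 1) = 1"
      using shift[OF n3] n2 n3 by (simp only: padic_norm_divide)
    show ?thesis
    proof
      show "(\<Prod>i<k. if i = 0 then t / 2 else if i = 1 then 2 else -1) = t"
        unfolding m(1) prod.lessThan_Suc_shift using m(2) by simp
    qed (use t1 t3 n2 m1 in \<open>auto simp: padic_norm_divide\<close>)
  qed
qed

text \<open>The value \<open>c\<close> stored at the root is only the factor handed to each of its children: there is
  no edge into the root, hence no product condition there.\<close>

primrec descending_field :: "('a \<Rightarrow> 'a) \<Rightarrow> ('a \<Rightarrow> nat \<Rightarrow> 'a) \<Rightarrow> 'a \<Rightarrow> vertex \<Rightarrow> 'a" where
  "descending_field g W c [] = c"
| "descending_field g W c (i # y) = (if y = [] then g c else g (W (descending_field g W c y) i))"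

section \<open>The bounded and the unbounded measure\<close>

lemma near_one_squares:
  fixes J J1 a b :: "'p::prime_card padic"
  assumes "symmetric_model J J1 a b" "J1 \<noteq> 0"
  shows "near_one (a\<^sup>2) (b\<^sup>2)"
proof
  interpret symmetric_model k J J1 a b z for k z by fact
  show card: "CARD('p) \<ge> 3" by (rule card_ge_3)
  have ab: "padic_norm (a - 1) = padic_norm J" "padic_norm (b - 1) = padic_norm J1"
    using padic_exp_sub_1[OF card] norm_J norm_J1 by (auto simp: a_def b_def)
  have "padic_norm (x\<^sup>2 - 1) \<le> padic_norm (x - 1)" if "padic_norm x = 1" for x :: "'p padic"
    using padic_norm_power_diff_le[of x 1 2] that by simp
  then show "padic_norm (a\<^sup>2 - 1) \<le> 1 / real CARD('p)" "padic_norm (b\<^sup>2 - 1) \<le> 1 / real CARD('p)"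
    using norm_ab norm_J norm_J1 unfolding ab[symmetric] by (meson order_trans)+
  have "1 / real CARD('p) < 1" using card by simp
  then have "padic_norm (b - 1) < 1" using ab norm_J1 by linarith
  moreover have "padic_norm (2 :: 'p padic) = 1"
    using card by (intro padic_norm_numeral_eq_1) (auto dest: dvd_imp_le)
  \<comment> \<open>The number \<open>b - 1\<close> is small but 2 is a unit; this rules out
    \<open>b = - 1\<close>, the other root of \<open>b\<^sup>2 = 1\<close>.\<close>
  ultimately have "b - 1 \<noteq> - 2" by (metis less_irrefl padic_norm_minus)
  then have "b \<noteq> - 1" by auto
  moreover have "b \<noteq> 1" using ab(2) assms(2) by auto
  ultimately show "b\<^sup>2 \<noteq> 1" by (simp add: power2_eq_1_iff)
qed

text \<open>For the constant field at the fixed point near 1, the root factors and all level factors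
  are units. Hence so are the partition functions and the probabilities of single
  configurations.\<close>

lemma exists_bounded_quasi_gibbs_measure:
  fixes J J1 a b :: "'p::prime_card padic"
  assumes "symmetric_model J J1 a b" "J1 \<noteq> 0"
  shows "\<exists>\<mu>. quasi_gibbs_measure k J J1 \<mu> \<and> padic_bounded (cylinder_sets k) \<mu>"
proof -
  interpret near_one "a\<^sup>2" "b\<^sup>2" by (rule near_one_squares[OF assms])
  obtain \<zeta> where \<zeta>: "padic_norm (\<zeta> - 1) \<le> 1 / real CARD('p)" "edge_map (a\<^sup>2) (b\<^sup>2) \<zeta> ^ k = \<zeta>"
    by (rule fixed_point_near_one)
  note norms = edge_map_near_one(1,2)[OF \<zeta>(1)]
  have \<zeta>_norm: "padic_norm \<zeta> = 1"
    using \<zeta>(1) inverse_card padic_norm_eqI[of \<zeta> 1] by auto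
  interpret symmetric_model k J J1 a b "\<lambda>_. \<zeta>" by fact
  interpret symmetric_solution k J J1 a b "\<lambda>_. \<zeta>"
  proof
    show "\<zeta> = (\<Prod>i<k. (a\<^sup>2 * b\<^sup>2 * \<zeta> + 1) / (a\<^sup>2 * \<zeta> + b\<^sup>2))"
      using \<zeta>(2) by (simp add: edge_map_def)
    show "a\<^sup>2 * \<zeta> + b\<^sup>2 \<noteq> 0" "a\<^sup>2 * \<zeta> + 1 \<noteq> 0"
      using norms by (metis padic_norm_0 zero_neq_one)+
  qed
  interpret compatible_field k J J1 "sym_field (\<lambda>_. \<zeta>)"
    by unfold_locales (rule sym_field_defined sym_field_compatible)+
  have "padic_norm (level_factor n) = 1" for n
    unfolding level_factor_def padic_norm_prod by (simp add: padic_norm_divide padic_norm_mult norms norm_ab)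
  then have "padic_norm (partition_function k J J1 (sym_field (\<lambda>_. \<zeta>)) (Suc n)) = 1" for n
    unfolding partition_function_eq padic_norm_mult padic_norm_prod
    by (simp add: padic_norm_divide norms norm_ab)
  then have "padic_norm (gibbs_finite k J J1 (sym_field (\<lambda>_. \<zeta>)) n \<sigma>) \<le> 1"
    if "n \<ge> 1" "\<sigma> \<in> configs (tree_ball k n)" for n \<sigma>
    using that norm_gibbs_finite[of \<sigma> "n - 1"] \<zeta>_norm by (cases n) auto
  then show ?thesis
    using quasi_gibbs_field_measure field_measure_bounded by blast
qed

text \<open>Along the descending field every denominator has the same norm
  \<open>\<delta> < 1\<close>, so the partition functions tend to 0 while all weights remain
  units.\<close>

lemma exists_unbounded_quasi_gibbs_measure:
  fixes J J1 a b :: "'p::prime_card padic"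
  assumes "symmetric_model J J1 a b" "J1 \<noteq> 0" and k: "k \<ge> 1" "odd k \<or> CARD('p) \<ge> 5"
  shows "\<exists>\<nu>. quasi_gibbs_measure k J J1 \<nu> \<and> \<not> padic_bounded (cylinder_sets k) \<nu>"
proof -
  interpret near_one "a\<^sup>2" "b\<^sup>2" by (rule near_one_squares[OF assms(1,2)])
  define good where "good w \<longleftrightarrow> padic_norm w = 1 \<and> padic_norm (w - 1) = 1" for w :: "'p padic"
  \<comment> \<open>The condition on \<open>t\<close> stays inside the existential, so that choice
    yields a total \<open>W\<close> that can be passed to \<open>descending_field\<close>.\<close>
  have "\<forall>t. \<exists>w. padic_norm (t + 1 :: 'p padic) < 1 \<longrightarrow> (\<Prod>i<k. w i) = t \<and> (\<forall>i. good (w i))"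
    using unit_factorization[OF card_ge_3 k] unfolding good_def by metis
  then obtain W where W: "\<And>t :: 'p padic. padic_norm (t + 1) < 1 \<Longrightarrow> (\<Prod>i<k. W t i) = t \<and> (\<forall>i. good (W t i))"
    by metis
  define g where "g = edge_inv (a\<^sup>2) (b\<^sup>2)"
  \<comment> \<open>The number p - 1 is a unit not congruent to 1, so its preimage lies near -1. It
    also differs from -1, which keeps the root factor \<open>a\<^sup>2 * z [i] + 1\<close>, a
    multiple of \<open>c + 1\<close>, nonzero.\<close>
  define c :: "'p padic" where "c = of_nat (CARD('p) - 1)"
  define z where "z = descending_field g W c"
  have c: "good c" "c + 1 \<noteq> 0"
  proof -
    have "c - 1 = of_nat (CARD('p) - 2)" "c + 1 = of_nat CARD('p)"
      using card_ge_3 by (simp_all add: c_def of_nat_diff)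
    moreover have "\<not> CARD('p) dvd CARD('p) - 1" "\<not> CARD('p) dvd CARD('p) - 2"
      using card_ge_3 by (auto dest: dvd_imp_le)
    ultimately show "good c" "c + 1 \<noteq> 0"
      using card_ge_3 by (auto simp: good_def c_def padic_norm_of_nat_eq_1 simp del: of_nat_diff)
  qed
  have near: "padic_norm (g w + 1) < 1" if "good w" for w
    using edge_inv_near_minus_one(2) that by (simp add: g_def good_def)
  \<comment> \<open>The descent never stops: a value at a parent other than the root is a preimage,
    hence near -1, hence factors again into units whose preimages go to the children.\<close>
  have z_good: "\<exists>w. good w \<and> z y = g w" if "y \<noteq> []" for y
    using that
  proof (induction y)
    case (Cons i y)
    show ?case
    proof (cases "y = []")
      case False
      then have "padic_norm (z y + 1) < 1" using Cons.IH near by auto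
      then show ?thesis using False W[of "z y"] by (auto simp: z_def)
    qed (use c in \<open>auto simp: z_def\<close>)
  qed simp
  have z_near: "padic_norm (z y + 1) < 1" if "y \<noteq> []" for y
    using z_good[OF that] near by auto
  have good_neq: "b\<^sup>2 - w \<noteq> 0" if "good w" for w
    using edge_inv_near_minus_one(1)[of w] that unfolding good_def by (metis padic_norm_0 zero_neq_one)
  have z_denominator: "padic_norm (a\<^sup>2 * z y + b\<^sup>2) = padic_norm (b\<^sup>2 ^ 2 - 1)" if y: "y \<noteq> []" for y
  proof -
    obtain w where w: "good w" "z y = g w" using z_good[OF y] by blast
    then show ?thesis
      using edge_inv_identities(1)[OF AB_nonzero(1) good_neq] edge_inv_near_minus_one(1)[of w]
      by (simp add: g_def good_def padic_norm_divide)
  qed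
  interpret symmetric_model k J J1 a b z by fact
  interpret symmetric_solution k J J1 a b z
  proof
    fix y :: vertex assume y: "y \<noteq> []"
    \<comment> \<open>The child received the preimage of \<open>W (z y) i\<close>, so the edge map
      returns this factor, and the factors multiply to \<open>z y\<close>.\<close>
    have "(a\<^sup>2 * b\<^sup>2 * z (i # y) + 1) / (a\<^sup>2 * z (i # y) + b\<^sup>2) = W (z y) i" for i
    proof -
      have "good (W (z y) i)" using W z_near[OF y] by blast
      then show ?thesis
        using y edge_map_edge_inv[OF AB_nonzero(1) good_neq B_sq_neq]
        by (simp add: z_def g_def edge_map_def)
    qed
    then show "z y = (\<Prod>i<k. (a\<^sup>2 * b\<^sup>2 * z (i # y) + 1) / (a\<^sup>2 * z (i # y) + b\<^sup>2))"
      using W[OF z_near[OF y]] by simp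
    show "a\<^sup>2 * z y + b\<^sup>2 \<noteq> 0"
      using z_denominator[OF y] B_sq_neq by (metis padic_norm_eq_0_iff right_minus_eq)
  next
    fix i
    show "a\<^sup>2 * z [i] + 1 \<noteq> 0"
      using edge_inv_identities(2)[OF AB_nonzero(1) good_neq[OF c(1)]] good_neq[OF c(1)] c(2) B_neq
      by (simp add: z_def g_def)
  qed
  interpret compatible_field k J J1 "sym_field z"
    by unfold_locales (rule sym_field_defined sym_field_compatible)+
  define \<delta> where "\<delta> = padic_norm (b\<^sup>2 ^ 2 - 1)"
  have \<delta>: "\<delta> < 1" "\<delta> \<ge> 0" using norm_B_sq B_near inverse_card by (auto simp: \<delta>_def)
  have level: "padic_norm (level_factor n) \<le> \<delta>" for n
  proof -
    have "padic_norm ((a\<^sup>2 * z y + b\<^sup>2) / (a * b)) = \<delta>" if "y \<in> tree_sphere k (Suc n)" for y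
      using that z_denominator[of y]
      by (cases y) (auto simp: padic_norm_divide padic_norm_mult norm_ab tree_sphere_eq \<delta>_def)
    then have "padic_norm (level_factor n) = \<delta> ^ card (tree_sphere k (Suc n))"
      by (simp add: level_factor_def padic_norm_prod)
    \<comment> \<open>A path through first children shows that the sphere is nonempty, so the power
      of \<open>\<delta>\<close> has exponent at least 1.\<close>
    moreover have "replicate (Suc n) 0 \<in> tree_sphere k (Suc n)"
      using k(1) by (simp add: tree_sphere_eq tree_vertices_def del: replicate_Suc)
    then have "card (tree_sphere k (Suc n)) \<ge> 1"
      using finite_tree_sphere card_gt_0_iff by (metis One_nat_def Suc_leI empty_iff)
    then have "\<delta> ^ card (tree_sphere k (Suc n)) \<le> \<delta> ^ 1"
      using \<delta> by (intro power_decreasing) auto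
    ultimately show ?thesis by simp
  qed
  define Z where "Z n = padic_norm (partition_function k J J1 (sym_field z) (Suc n))" for n
  have Z_pos: "Z n > 0" for n
    using partition_function_nonzero[of "Suc n"] by (simp add: Z_def less_le)
  have Z_le: "Z n \<le> Z 0 * \<delta> ^ n" for n
  proof -
    have "(\<Prod>j<n. padic_norm (level_factor (Suc j))) \<le> (\<Prod>j<n. \<delta>)"
      using level by (intro prod_mono) auto
    then have "Z 0 * (\<Prod>j<n. padic_norm (level_factor (Suc j))) \<le> Z 0 * \<delta> ^ n"
      using Z_pos[of 0] by (intro mult_left_mono) auto
    moreover have "Z n = Z 0 * (\<Prod>j<n. padic_norm (level_factor (Suc j)))"
      unfolding Z_def partition_function_eq by (simp add: padic_norm_mult padic_norm_prod)
    ultimately show ?thesis by simp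
  qed
  have "\<exists>n\<ge>1. \<exists>\<sigma>\<in>configs (tree_ball k n). padic_norm (gibbs_finite k J J1 (sym_field z) n \<sigma>) > C" for C
  proof -
    \<comment> \<open>A positive bound above \<open>C\<close>, so that \<open>1 / (Z 0 * C')\<close>
      is positive also for negative \<open>C\<close>.\<close>
    define C' where "C' = \<bar>C\<bar> + 1"
    have C': "C' > 0" "C < C'" by (auto simp: C'_def)
    then obtain n where "\<delta> ^ n < 1 / (Z 0 * C')"
      using real_arch_pow_inv[of "1 / (Z 0 * C')" \<delta>] \<delta> Z_pos[of 0] by auto
    then have "Z 0 * \<delta> ^ n * C' < 1" using C' Z_pos[of 0] by (simp add: field_simps)
    moreover have "Z n * C' \<le> Z 0 * \<delta> ^ n * C'"
      using Z_le[of n] C'(1) by (intro mult_right_mono) auto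
    ultimately have "C' * Z n < 1" by (simp add: mult.commute)
    then have "C' < 1 / Z n" using Z_pos[of n] by (simp add: pos_less_divide_eq)
    then have "C < 1 / Z n" using C'(2) by (rule less_trans[rotated])
    moreover obtain \<sigma> where \<sigma>: "\<sigma> \<in> configs (tree_ball k (Suc n))"
      using configs_extend[of "{}" "tree_ball k (Suc n)" "\<lambda>_. undefined"] by (auto simp: configs_def)
    moreover have "padic_norm (z y) = 1" if "y \<noteq> []" for y
      using padic_norm_eqI[of "z y" "- 1"] z_near[OF that] by simp
    then have "padic_norm (gibbs_finite k J J1 (sym_field z) (Suc n) \<sigma>) = 1 / Z n"
      unfolding Z_def using \<sigma> by (intro norm_gibbs_finite) auto
    ultimately show ?thesis by (intro exI[of _ "Suc n"] conjI bexI[of _ \<sigma>]) simp_all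
  qed
  then show ?thesis
    using quasi_gibbs_field_measure field_measure_unbounded by blast
qed

section \<open>Coexistence of a bounded and an unbounded quasi Gibbs measure\<close>

theorem theorem6p2:
  fixes p k :: nat and J J1 a b :: "'p::prime_card padic"
  assumes "p = CARD('p)" and "prime p" and "p \<ge> 3" and "k \<ge> 1"
    and "padic_norm J \<le> 1 / real p"
    and "0 < padic_norm J1" and "padic_norm J1 \<le> 1 / real p"
    and "a = padic_exp J" and "b = padic_exp J1"
    and "(gcd k p = 1 \<and> even ((p - 1) div gcd k (p - 1))) \<or>
         (odd k \<and> max (padic_norm (of_nat k :: 'p padic)) (padic_norm (a - 1)) < padic_norm (b - 1))"
  shows "phase_transition k J J1"
proof -
  have model: "symmetric_model J J1 a b"
    using assms by unfold_locales auto
  have "J1 \<noteq> 0" using assms(6) by auto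
  \<comment> \<open>Condition (ii) contains that \<open>k\<close> is odd. Under (i), an even
    \<open>k\<close> with p = 3 would give gcd 2 and the odd quotient 2 / 2 = 1.\<close>
  have "odd k \<or> p \<ge> 5"
  proof (rule ccontr)
    assume "\<not> (odd k \<or> p \<ge> 5)"
    moreover from this have "p \<noteq> 4" using assms(2) by (auto simp: prime_nat_iff dest: spec[of _ 2])
    ultimately have "even k" "p = 3" using assms(3) by auto
    moreover from this have "gcd k (p - 1) = 2" by (simp add: gcd_nat.absorb2)
    ultimately show False using assms(10) by simp
  qed
  then obtain \<nu> where \<nu>: "quasi_gibbs_measure k J J1 \<nu>" "\<not> padic_bounded (cylinder_sets k) \<nu>"
    using exists_unbounded_quasi_gibbs_measure[OF model \<open>J1 \<noteq> 0\<close> assms(4)] assms(1) by auto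
  obtain \<mu> where \<mu>: "quasi_gibbs_measure k J J1 \<mu>" "padic_bounded (cylinder_sets k) \<mu>"
    using exists_bounded_quasi_gibbs_measure[OF model \<open>J1 \<noteq> 0\<close>] by blast
  \<comment> \<open>Measures that agree on all cylinder sets would be bounded or unbounded
    together.\<close>
  have "\<exists>A\<in>cylinder_sets k. \<mu> A \<noteq> \<nu> A"
  proof (rule ccontr)
    assume "\<not> ?thesis"
    then have "(\<lambda>A. padic_norm (\<mu> A)) ` cylinder_sets k = (\<lambda>A. padic_norm (\<nu> A)) ` cylinder_sets k"
      by (intro image_cong) auto
    then show False using \<mu>(2) \<nu>(2) by (simp add: padic_bounded_def)
  qed
  with \<mu> \<nu> show ?thesis unfolding phase_transition_def by blast
qed

end
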